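(* Let $u_{\rm ref}$ be the reference solution, let $(u_k)_{k\ge 0}$ be the iterates of the Sinclair iteration started from an initial guess $u_0$, and let $\mathcal{T},\mathcal{T}_{\rm e}$ be the associated iteration operator and modeling-error operator (all defined in the context). Assume that $\mathcal{T}$ admits an eigendecomposition $\mathcal{T}=\mathcal{Q}\mathcal{D}\mathcal{Q}^{-1}$. Let $\sigma=\sigma(\mathcal{T})$ be the spectral radius of $\mathcal{T}$ (with $\sigma\neq1$, so that the expression below is defined). Then the norm of the error in the $(k+1)$-th iteration is bounded by $$\|u_{\rm ref}-u_{k+1}\|\le \sigma^{k+1}\|\mathcal{Q}\|\,\|\mathcal{Q}^{-1}\|\Big(\|u_{\rm ref}-u_0\|-\frac{1}{1-\sigma}\|\mathcal{T}_{\rm e}[u_{\rm ref}]\|\Big)+\frac{1}{1-\sigma}\|\mathcal{Q}\|\,\|\mathcal{Q}^{-1}\|\,\|\mathcal{T}_{\rm e}[u_{\rm ref}]\|.$$ Moreover, the spectral radius of $\mathcal{T}$ equals the spectral radius of its block $\mathcal{T}^{\rm p|p}$, i.e. $\sigma=\sigma(\mathcal{T}^{\rm p|p})$.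
   Context: Domains. $\Lambda_\infty\subset\mathbb{R}^d$ ($d\in\{1,2,3\}$) is a Bravais lattice and $\Lambda\subseteq\Lambda_\infty$ is the computational domain, bounded or unbounded (the case $\Lambda=\Lambda_\infty$ is included). It is the disjoint union $\Lambda=\Lambda^{\rm a}\cup\Lambda^{\rm c}$ of a finite atomistic domain $\Lambda^{\rm a}$ and a (possibly infinite) continuum domain $\Lambda^{\rm c}$. Functions take values in $\mathbb{R}^d$; $\mathcal{V}(\Lambda)$ is the space of admissible finite-energy displacements on $\Lambda$ (square-integrable gradient of a suitable interpolant, prescribed values $\bar u$ outside $\Lambda$). Every atom $\xi$ has a finite interaction range $\mathcal{R}_\xi$ and a smaller (nearest-neighbour) range $\mathcal{R}^{\rm h}_\xi\subset\mathcal{R}_\xi$. The pad $\Lambda^{\rm p}\subset\Lambda^{\rm c}$ is the set of nodes of $\Lambda^{\rm c}$ with which atoms of $\Lambda^{\rm a}$ interact according to $\mathcal{R}_\xi$; atoms of $\Lambda^{\rm a}$ interact only with $\Lambda^{\rm a}\cup\Lambda^{\rm p}$. For bounded $\Lambda$, $\Lambda^{\rm o}$ is the outer boundary, i.e. the nodes outside $\Lambda$ that interact via $\mathcal{R}^{\rm h}$ with $\Lambda^{\rm c}$, where the displacement is prescribed to be $\bar u$; for $\Lambda=\Lambda_\infty$ there is no outer boundary and all terms with index o are absent. Operators. $\mathcal{L}_{\rm hnl}[v](\xi)=\sum_{\eta\in\mathcal{R}_\xi}K_{\rm hnl}(\xi,\eta)v(\eta)$ is the linearized nonlocal atomistic operator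 and $\mathcal{L}_{\rm h}[v](\xi)=\sum_{\eta\in\mathcal{R}^{\rm h}_\xi}K_{\rm h}(\xi-\eta)v(\eta)$ is the linear local harmonic (continuum) operator, with interatomic force-constant kernels $K_{\rm hnl}$, $K_{\rm h}$. $\mathcal{L}^{\rm x|y}$ is the block of $\mathcal{L}$ mapping functions on $\Lambda^{\rm y}$ to functions on $\Lambda^{\rm x}$; $v^{\rm x}$ is the restriction of $v$ to $\Lambda^{\rm x}$; $\mathcal{I}$ and $0$ are the identity and zero operators. All inverses appearing below are assumed to exist, and $$\mathcal{S}^{\rm c|c}=\mathcal{L}_{\rm h}^{\rm c|c}-\mathcal{L}_{\rm h}^{\rm c|a}(\mathcal{L}_{\rm h}^{\rm a|a})^{-1}\mathcal{L}_{\rm h}^{\rm a|c}.$$ Reference solution. $u_{\rm ref}$ is the unique solution of the fully atomistic linearized problem $\mathcal{L}_{\rm hnl}[u_{\rm ref}]=f_{\rm ext}$ in $\Lambda$, $u_{\rm ref}=\bar u$ outside $\Lambda$, for a given external force $f_{\rm ext}$ with compact support. Sinclair iteration (for the coupled problem with $\mathcal{L}_{\rm hnl}$ in $\Lambda^{\rm a}$ and $\mathcal{L}_{\rm h}$ in $\Lambda^{\rm c}$). Given $u_k$: (anharmonic step) $u_{k+1}^{\rm a}$ solves $\mathcal{L}_{\rm hnl}^{\rm a|a}[u^{\rm a}_{k+1}]+\mathcal{L}_{\rm hnl}^{\rm a|c}[u^{\rm c}_k]=f_{\rm ext}^{\rm a}$; (harmonic step) $u_{k+1}^{\rm c}=u_k^{\rm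 c}-(\mathcal{S}^{\rm c|c})^{-1}[f_{{\rm inh},k+1}]$ with the inhomogeneous force $f_{{\rm inh},k+1}=\mathcal{L}_{\rm h}^{\rm c|a}[u^{\rm a}_{k+1}]+\mathcal{L}_{\rm h}^{\rm c|c}[u^{\rm c}_k]+\mathcal{L}_{\rm h}^{\rm c|o}[\bar u]-f_{\rm ext}^{\rm c}$. Iteration operator and modeling-error operator $\mathcal{T},\mathcal{T}_{\rm e}:\mathcal{V}(\Lambda)\to\mathcal{V}(\Lambda)$, in block form with respect to (a, c): $$\mathcal{T}=\begin{pmatrix}0&-(\mathcal{L}_{\rm hnl}^{\rm a|a})^{-1}\mathcal{L}_{\rm hnl}^{\rm a|c}\\0&\mathcal{I}^{\rm c|c}-(\mathcal{S}^{\rm c|c})^{-1}\big(\mathcal{L}_{\rm h}^{\rm c|c}-\mathcal{L}_{\rm h}^{\rm c|a}(\mathcal{L}_{\rm hnl}^{\rm a|a})^{-1}\mathcal{L}_{\rm hnl}^{\rm a|c}\big)\end{pmatrix},$$ $$\mathcal{T}_{\rm e}=\begin{pmatrix}0&0\\(\mathcal{S}^{\rm c|c})^{-1}(\mathcal{L}_{\rm hnl}^{\rm c|a}-\mathcal{L}_{\rm h}^{\rm c|a})&(\mathcal{S}^{\rm c|c})^{-1}(\mathcal{L}_{\rm hnl}^{\rm c|c}-\mathcal{L}_{\rm h}^{\rm c|c})\end{pmatrix}.$$ $\mathcal{T}^{\rm p|p}$ is the block of $\mathcal{T}$ mapping functions on $\Lambda^{\rm p}$ to functions on $\Lambda^{\rm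 p}$. Norms. $\|v\|=(\sum_{\xi\in\Lambda}|v(\xi)|^2)^{1/2}$ for functions, and $\|\cdot\|$ for operators is the induced operator norm. In the eigendecomposition $\mathcal{D}$ is the diagonal operator of eigenvalues.
   Formalization: The error bound further assumes that L_hnl and L_h exert the same force on Λ^c from the prescribed values ū outside Λ (without this it can fail for ū ≠ 0), and that ‖Q‖, ‖Q^{-1}‖, ‖u_ref − u_0‖ and ‖T_e[u_ref]‖ are finite. *)

theory Defs
  imports "HOL-Analysis.Analysis" "HOL-Library.Function_Algebras"
begin

section \<open>Lattice functions\<close>

definition bravais :: "real^'d^'d \<Rightarrow> (real^'d) set" where
  "bravais A = {A *v z | z. \<forall>i. z $ i \<in> \<int>}"

text \<open>
  A function on a set \<open>X\<close> of lattice sites is represented by its extension by zero to all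
  points of the type, so that functions on the atomistic and on the continuum domain can be
  added and a pair \<open>(v\<^sup>a, v\<^sup>c)\<close> is the function \<open>v\<^sup>a + v\<^sup>c\<close>.
\<close>

definition funs_on :: "'a set \<Rightarrow> ('a \<Rightarrow> 'b::zero) set" where
  "funs_on X = {v. \<forall>\<xi>. \<xi> \<notin> X \<longrightarrow> v \<xi> = 0}"

definition restr :: "'a set \<Rightarrow> ('a \<Rightarrow> 'b::zero) \<Rightarrow> 'a \<Rightarrow> 'b" where
  "restr X v = (\<lambda>\<xi>. if \<xi> \<in> X then v \<xi> else 0)"

text \<open>\<open>block X Y L\<close> is the block of \<open>L\<close> that maps functions on \<open>Y\<close> to functions on \<open>X\<close>.\<close>

definition block ::
  "'a set \<Rightarrow> 'a set \<Rightarrow> (('a \<Rightarrow> 'b::zero) \<Rightarrow> 'a \<Rightarrow> 'b) \<Rightarrow> ('a \<Rightarrow> 'b) \<Rightarrow> 'a \<Rightarrow> 'b" where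
  "block X Y L v = restr X (L (restr Y v))"

definition linear_space :: "('a \<Rightarrow> 'b::real_vector) set \<Rightarrow> bool" where
  "linear_space V \<longleftrightarrow>
     0 \<in> V \<and> (\<forall>v\<in>V. \<forall>w\<in>V. v + w \<in> V) \<and> (\<forall>c. \<forall>v\<in>V. (\<lambda>\<xi>. c *\<^sub>R v \<xi>) \<in> V)"

definition finitely_supported :: "('a \<Rightarrow> 'b::zero) \<Rightarrow> bool" where
  "finitely_supported v \<longleftrightarrow> finite {\<xi>. v \<xi> \<noteq> 0}"


section \<open>Finite energy\<close>

text \<open>
  The interpolant is the continuous function that is affine in each lattice coordinate on every
  lattice cell. It is differentiable in the interior of the cells, and the remaining points form
  a null set. The energy is taken over those cells all of whose corners belong to \<open>\<Lambda>\<close>.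
\<close>

definition cell_corner :: "real^'d^'d \<Rightarrow> real^'d \<Rightarrow> 'd set \<Rightarrow> real^'d" where
  "cell_corner A x e =
     A *v (\<chi> i. of_int \<lfloor>(matrix_inv A *v x) $ i\<rfloor> + (if i \<in> e then 1 else 0))"

definition interpolant :: "real^'d^'d \<Rightarrow> (real^'d \<Rightarrow> real^'d) \<Rightarrow> real^'d \<Rightarrow> real^'d" where
  "interpolant A v x =
     (\<Sum>e\<in>(UNIV :: 'd set set).
        (\<Prod>i\<in>UNIV. if i \<in> e then frac ((matrix_inv A *v x) $ i)
                   else 1 - frac ((matrix_inv A *v x) $ i)) *\<^sub>R v (cell_corner A x e))"

definition finite_energy ::
  "real^'d^'d \<Rightarrow> (real^'d) set \<Rightarrow> (real^'d \<Rightarrow> real^'d) \<Rightarrow> bool" where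
  "finite_energy A \<Lambda> v \<longleftrightarrow>
     set_integrable lebesgue {x. \<forall>e. cell_corner A x e \<in> \<Lambda>}
       (\<lambda>x. (onorm (frechet_derivative (interpolant A v) (at x)))\<^sup>2)"


section \<open>Norms\<close>

definition square_summable :: "'a set \<Rightarrow> ('a \<Rightarrow> 'b::real_normed_vector) \<Rightarrow> bool" where
  "square_summable X v \<longleftrightarrow> (\<lambda>\<xi>. (norm (v \<xi>))\<^sup>2) summable_on X"

definition l2norm :: "'a set \<Rightarrow> ('a \<Rightarrow> 'b::real_normed_vector) \<Rightarrow> real" where
  "l2norm X v = sqrt (\<Sum>\<^sub>\<infinity>\<xi>\<in>X. (norm (v \<xi>))\<^sup>2)"

text \<open>
  Finite-energy functions on an infinite \<open>X\<close> need not be square summable. The operator norm on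
  a space \<open>V\<close> of functions on \<open>X\<close> is the supremum over the square summable members of \<open>V\<close>; it is
  a meaningful real number only for operators that are bounded in the following sense. As for
  \<^const>\<open>onorm\<close>, the quotient is \<open>0\<close> for \<open>v = 0\<close>.
\<close>

definition l2_bounded ::
  "'a set \<Rightarrow> ('a \<Rightarrow> 'b::real_normed_vector) set \<Rightarrow> (('a \<Rightarrow> 'b) \<Rightarrow> 'a \<Rightarrow> 'b) \<Rightarrow> bool" where
  "l2_bounded X V B \<longleftrightarrow>
     (\<exists>C. \<forall>v\<in>V. square_summable X v \<longrightarrow>
        square_summable X (B v) \<and> l2norm X (B v) \<le> C * l2norm X v)"

definition op_norm ::
  "'a set \<Rightarrow> ('a \<Rightarrow> 'b::real_normed_vector) set \<Rightarrow> (('a \<Rightarrow> 'b) \<Rightarrow> 'a \<Rightarrow> 'b) \<Rightarrow> real" where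
  "op_norm X V B = (SUP v\<in>{v\<in>V. square_summable X v}. l2norm X (B v) / l2norm X v)"


section \<open>Spectral notions\<close>

text \<open>Eigenvalues and eigenvectors are complex, so real operators are complexified first.\<close>

definition re_part :: "('a \<Rightarrow> complex^'d) \<Rightarrow> 'a \<Rightarrow> real^'d" where
  "re_part w = (\<lambda>\<xi>. \<chi> i. Re (w \<xi> $ i))"

definition im_part :: "('a \<Rightarrow> complex^'d) \<Rightarrow> 'a \<Rightarrow> real^'d" where
  "im_part w = (\<lambda>\<xi>. \<chi> i. Im (w \<xi> $ i))"

definition cspace :: "('a \<Rightarrow> real^'d) set \<Rightarrow> ('a \<Rightarrow> complex^'d) set" where
  "cspace V = {w. re_part w \<in> V \<and> im_part w \<in> V}"

definition cop ::
  "(('a \<Rightarrow> real^'d) \<Rightarrow> 'a \<Rightarrow> real^'d) \<Rightarrow> ('a \<Rightarrow> complex^'d) \<Rightarrow> 'a \<Rightarrow> complex^'d" where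
  "cop B w = (\<lambda>\<xi>. \<chi> i. Complex (B (re_part w) \<xi> $ i) (B (im_part w) \<xi> $ i))"

definition op_spectrum ::
  "('a \<Rightarrow> complex^'d) set \<Rightarrow> (('a \<Rightarrow> complex^'d) \<Rightarrow> 'a \<Rightarrow> complex^'d) \<Rightarrow> complex set" where
  "op_spectrum W B = {z. \<not> bij_betw (\<lambda>w. B w - (\<lambda>\<xi>. z *s w \<xi>)) W W}"

text \<open>Inserting \<open>0\<close> only matters for the zero space, whose spectrum is empty.\<close>

definition op_spectral_radius ::
  "('a \<Rightarrow> complex^'d) set \<Rightarrow> (('a \<Rightarrow> complex^'d) \<Rightarrow> 'a \<Rightarrow> complex^'d) \<Rightarrow> real" where
  "op_spectral_radius W B = Sup (insert 0 (cmod ` op_spectrum W B))"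

definition clinear_on ::
  "('a \<Rightarrow> complex^'d) set \<Rightarrow> (('a \<Rightarrow> complex^'d) \<Rightarrow> 'a \<Rightarrow> complex^'d) \<Rightarrow> bool" where
  "clinear_on W Q \<longleftrightarrow>
     (\<forall>v\<in>W. \<forall>w\<in>W. Q (v + w) = Q v + Q w) \<and>
     (\<forall>c. \<forall>w\<in>W. Q (\<lambda>\<xi>. c *s w \<xi>) = (\<lambda>\<xi>. c *s Q w \<xi>))"

definition diag_op ::
  "('a \<Rightarrow> complex^'d) \<Rightarrow> ('a \<Rightarrow> complex^'d) \<Rightarrow> 'a \<Rightarrow> complex^'d" where
  "diag_op mu w = (\<lambda>\<xi>. \<chi> i. mu \<xi> $ i * w \<xi> $ i)"

text \<open>
  \<open>B = Q D Q\<^sup>-\<^sup>1\<close> on \<open>W\<close> with \<open>D\<close> diagonal in the basis of the unit functions at site \<open>\<xi>\<close> in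
  direction \<open>i\<close>; \<open>Q\<close> maps these to eigenvectors of \<open>B\<close> with eigenvalues \<open>mu \<xi> $ i\<close>.
\<close>

definition eigendecomposition ::
  "('a \<Rightarrow> complex^'d) set \<Rightarrow> (('a \<Rightarrow> complex^'d) \<Rightarrow> 'a \<Rightarrow> complex^'d) \<Rightarrow>
   (('a \<Rightarrow> complex^'d) \<Rightarrow> 'a \<Rightarrow> complex^'d) \<Rightarrow> ('a \<Rightarrow> complex^'d) \<Rightarrow> bool" where
  "eigendecomposition W B Q mu \<longleftrightarrow>
     clinear_on W Q \<and> bij_betw Q W W \<and> (\<forall>w\<in>W. diag_op mu w \<in> W) \<and>
     (\<forall>w\<in>W. B w = Q (diag_op mu (inv_into W Q w)))"


section \<open>The coupled problem\<close>

text \<open>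
  \<open>disp P\<close> is the space of finite-energy functions on \<open>\<Lambda>\<close>, and \<open>force P\<close> the space of forces on
  the continuum domain on which the inverse of the Schur complement is defined.
\<close>

record ('d::finite) problem =
  cell :: "real^'d^'d"
  atoms :: "(real^'d) set"
  cont :: "(real^'d) set"
  rng :: "real^'d \<Rightarrow> (real^'d) set"
  rng_h :: "real^'d \<Rightarrow> (real^'d) set"
  K_hnl :: "real^'d \<Rightarrow> real^'d \<Rightarrow> real^'d^'d"
  K_h :: "real^'d \<Rightarrow> real^'d^'d"
  disp :: "(real^'d \<Rightarrow> real^'d) set"
  force :: "(real^'d \<Rightarrow> real^'d) set"
  ubar :: "real^'d \<Rightarrow> real^'d"
  f_ext :: "real^'d \<Rightarrow> real^'d"

definition comp_domain :: "'d::finite problem \<Rightarrow> (real^'d) set" where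
  "comp_domain P = atoms P \<union> cont P"

definition pad :: "'d::finite problem \<Rightarrow> (real^'d) set" where
  "pad P = {\<eta> \<in> cont P. \<exists>\<xi>\<in>atoms P. \<eta> \<in> rng P \<xi>}"

definition exterior :: "'d::finite problem \<Rightarrow> (real^'d) set" where
  "exterior P = bravais (cell P) - comp_domain P"

definition outer :: "'d::finite problem \<Rightarrow> (real^'d) set" where
  "outer P = {\<eta> \<in> exterior P. \<exists>\<xi>\<in>cont P. \<eta> \<in> rng_h P \<xi>}"

definition L_hnl :: "'d::finite problem \<Rightarrow> (real^'d \<Rightarrow> real^'d) \<Rightarrow> real^'d \<Rightarrow> real^'d" where
  "L_hnl P v = (\<lambda>\<xi>. \<Sum>\<eta>\<in>rng P \<xi>. K_hnl P \<xi> \<eta> *v v \<eta>)"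

definition L_h :: "'d::finite problem \<Rightarrow> (real^'d \<Rightarrow> real^'d) \<Rightarrow> real^'d \<Rightarrow> real^'d" where
  "L_h P v = (\<lambda>\<xi>. \<Sum>\<eta>\<in>rng_h P \<xi>. K_h P (\<xi> - \<eta>) *v v \<eta>)"

definition cont_disp :: "'d::finite problem \<Rightarrow> (real^'d \<Rightarrow> real^'d) set" where
  "cont_disp P = disp P \<inter> funs_on (cont P)"

definition Schur :: "'d::finite problem \<Rightarrow> (real^'d \<Rightarrow> real^'d) \<Rightarrow> real^'d \<Rightarrow> real^'d" where
  "Schur P v =
     block (cont P) (cont P) (L_h P) v -
     block (cont P) (atoms P) (L_h P)
       (inv_into (funs_on (atoms P)) (block (atoms P) (atoms P) (L_h P))
         (block (atoms P) (cont P) (L_h P) v))"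

definition Schur_inv :: "'d::finite problem \<Rightarrow> (real^'d \<Rightarrow> real^'d) \<Rightarrow> real^'d \<Rightarrow> real^'d" where
  "Schur_inv P = inv_into (cont_disp P) (Schur P)"

definition hnl_aa_inv :: "'d::finite problem \<Rightarrow> (real^'d \<Rightarrow> real^'d) \<Rightarrow> real^'d \<Rightarrow> real^'d" where
  "hnl_aa_inv P = inv_into (funs_on (atoms P)) (block (atoms P) (atoms P) (L_hnl P))"

text \<open>
  The spaces \<open>disp P\<close> and \<open>force P\<close> are not fixed completely: on an infinite domain the
  behaviour at infinity (for instance the removal of constants) that makes the inverse of the
  Schur complement exist depends on the dimension and on the kernels. For a finite domain,
  \<open>disp P\<close> consists of all functions on \<open>\<Lambda>\<close> and \<open>force P\<close> may be taken to consist of all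
  functions on the continuum domain.
\<close>

definition well_posed :: "'d::finite problem \<Rightarrow> bool" where
  "well_posed P \<longleftrightarrow>
     invertible (cell P) \<and> CARD('d) \<in> {1, 2, 3} \<and>
     atoms P \<subseteq> bravais (cell P) \<and> cont P \<subseteq> bravais (cell P) \<and>
     atoms P \<inter> cont P = {} \<and> finite (atoms P) \<and>
     (\<forall>\<xi>\<in>bravais (cell P). finite (rng P \<xi>) \<and> rng P \<xi> \<subseteq> bravais (cell P) \<and>
        rng_h P \<xi> \<subseteq> rng P \<xi>) \<and>
     (\<forall>\<xi>\<in>atoms P. rng P \<xi> \<subseteq> atoms P \<union> pad P) \<and>
     finite {\<xi> \<in> comp_domain P. f_ext P \<xi> \<noteq> 0} \<and>
     linear_space (disp P) \<and> disp P \<subseteq> funs_on (comp_domain P) \<and>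
     (\<forall>v\<in>disp P. finite_energy (cell P) (comp_domain P) v) \<and>
     (\<forall>v\<in>funs_on (comp_domain P). finitely_supported v \<longrightarrow> v \<in> disp P) \<and>
     linear_space (force P) \<and> force P \<subseteq> funs_on (cont P) \<and>
     (\<forall>v\<in>disp P. \<forall>L\<in>{L_hnl P, L_h P}. \<forall>y\<in>{atoms P, cont P}. block (cont P) y L v \<in> force P) \<and>
     block (cont P) (outer P) (L_h P) (ubar P) - restr (cont P) (f_ext P) \<in> force P \<and>
     bij_betw (block (atoms P) (atoms P) (L_hnl P)) (funs_on (atoms P)) (funs_on (atoms P)) \<and>
     bij_betw (block (atoms P) (atoms P) (L_h P)) (funs_on (atoms P)) (funs_on (atoms P)) \<and>
     bij_betw (Schur P) (cont_disp P) (force P)"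

text \<open>A displacement is prescribed outside \<open>\<Lambda>\<close>; its restriction to \<open>\<Lambda>\<close> has finite energy.\<close>

definition admissible :: "'d::finite problem \<Rightarrow> (real^'d \<Rightarrow> real^'d) \<Rightarrow> bool" where
  "admissible P u \<longleftrightarrow> restr (comp_domain P) u \<in> disp P \<and> (\<forall>\<xi>. \<xi> \<notin> comp_domain P \<longrightarrow> u \<xi> = ubar P \<xi>)"

definition atomistic_solution :: "'d::finite problem \<Rightarrow> (real^'d \<Rightarrow> real^'d) \<Rightarrow> bool" where
  "atomistic_solution P u \<longleftrightarrow> admissible P u \<and> (\<forall>\<xi>\<in>comp_domain P. L_hnl P u \<xi> = f_ext P \<xi>)"

definition reference_solution :: "'d::finite problem \<Rightarrow> (real^'d \<Rightarrow> real^'d) \<Rightarrow> bool" where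
  "reference_solution P u \<longleftrightarrow>
     atomistic_solution P u \<and> (\<forall>w. atomistic_solution P w \<longrightarrow> w = u)"

text \<open>
  The atomistic operator may reach beyond \<^const>\<open>outer\<close>, so its action on the boundary values
  uses all sites outside \<open>\<Lambda>\<close>. The modeling error operator only compares the two operators on
  functions on \<open>\<Lambda>\<close>; the following condition says that they also exert the same boundary force
  on the continuum domain. It is trivially true if there are no sites outside \<open>\<Lambda>\<close> or if the
  boundary values vanish.
\<close>

definition consistent_boundary_force :: "'d::finite problem \<Rightarrow> bool" where
  "consistent_boundary_force P \<longleftrightarrow>
     block (cont P) (exterior P) (L_hnl P) (ubar P) = block (cont P) (outer P) (L_h P) (ubar P)"

definition inhomogeneous_force ::
  "'d::finite problem \<Rightarrow> (real^'d \<Rightarrow> real^'d) \<Rightarrow> (real^'d \<Rightarrow> real^'d) \<Rightarrow> real^'d \<Rightarrow> real^'d" where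
  "inhomogeneous_force P u' u =
     block (cont P) (atoms P) (L_h P) u' + block (cont P) (cont P) (L_h P) u +
     block (cont P) (outer P) (L_h P) (ubar P) - restr (cont P) (f_ext P)"

definition sinclair_step ::
  "'d::finite problem \<Rightarrow> (real^'d \<Rightarrow> real^'d) \<Rightarrow> (real^'d \<Rightarrow> real^'d) \<Rightarrow> bool" where
  "sinclair_step P u u' \<longleftrightarrow>
     block (atoms P) (atoms P) (L_hnl P) u' + block (atoms P) (cont P) (L_hnl P) u =
       restr (atoms P) (f_ext P) \<and>
     restr (cont P) u' = restr (cont P) u - Schur_inv P (inhomogeneous_force P u' u) \<and>
     (\<forall>\<xi>. \<xi> \<notin> comp_domain P \<longrightarrow> u' \<xi> = ubar P \<xi>)"

definition sinclair_iteration :: "'d::finite problem \<Rightarrow> (nat \<Rightarrow> real^'d \<Rightarrow> real^'d) \<Rightarrow> bool" where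
  "sinclair_iteration P u \<longleftrightarrow> admissible P (u 0) \<and> (\<forall>k. sinclair_step P (u k) (u (Suc k)))"

text \<open>The two summands are the atomistic and the continuum row of the block matrix.\<close>

definition T_iter :: "'d::finite problem \<Rightarrow> (real^'d \<Rightarrow> real^'d) \<Rightarrow> real^'d \<Rightarrow> real^'d" where
  "T_iter P v =
     - hnl_aa_inv P (block (atoms P) (cont P) (L_hnl P) v) +
     (restr (cont P) v -
      Schur_inv P (block (cont P) (cont P) (L_h P) v -
        block (cont P) (atoms P) (L_h P) (hnl_aa_inv P (block (atoms P) (cont P) (L_hnl P) v))))"

text \<open>The atomistic row is zero; the two summands are the columns of the continuum row.\<close>

definition T_err :: "'d::finite problem \<Rightarrow> (real^'d \<Rightarrow> real^'d) \<Rightarrow> real^'d \<Rightarrow> real^'d" where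
  "T_err P v =
     Schur_inv P (block (cont P) (atoms P) (L_hnl P) v - block (cont P) (atoms P) (L_h P) v) +
     Schur_inv P (block (cont P) (cont P) (L_hnl P) v - block (cont P) (cont P) (L_h P) v)"

end

theory Submission
  imports Defs
begin

text \<open>
  The error \<open>e\<^sub>k = u\<^sub>r\<^sub>e\<^sub>f - u\<^sub>k\<close> satisfies \<open>e\<^sub>k\<^sub>+\<^sub>1 = T e\<^sub>k - T\<^sub>e u\<^sub>r\<^sub>e\<^sub>f\<close>. In the
  coordinates \<open>x\<^sub>k = Q\<^sup>-\<^sup>1 e\<^sub>k\<close> the operator is diagonal with entries bounded by \<open>\<sigma>\<close>, and the
  bound follows by summing a geometric series. Cancelling \<open>S\<^sup>-\<^sup>1 S\<close> against the identity shows that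
  \<open>T v\<close> depends on \<open>v\<close> only through its values on the pad, so that \<open>T\<close> and its pad block have the
  same spectrum up to \<open>0\<close>. As the pad is finite, this spectrum is bounded; hence \<open>\<sigma>\<close> is a genuine
  supremum and dominates all eigenvalues.
\<close>

subsection \<open>Linear maps between spaces of functions\<close>

text \<open>The spectrum of \<open>T_iter P\<close> on \<open>disp P\<close> is purely algebraic
  (failure of bijectivity), and on an infinite domain nothing in its definition makes it a bounded
  set; \<open>Sup\<close> of an unbounded set of reals is an unspecified number. So the comparison
  with the pad block serves the error bound as much as the last claim. It matches solution sets of
  \<open>T w - z w = g\<close> and therefore works without norms or completeness; it divides by
  \<open>z\<close>, and the value \<open>0\<close> inserted into \<open>op_spectral_radius\<close>
  absorbs a possible difference at \<open>z = 0\<close>. In the estimate, square summability passes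
  through \<open>Q\<close>, its inverse and the diagonal factor only, and is proved along with the
  bound in eigenvector coordinates. Since \<open>Q\<close> and \<open>mu\<close> may be complex, the
  real errors are embedded into complex functions. The constant \<open>1 / (1 - \<sigma>)\<close>
  comes from the fixed point of the scalar recursion with factor \<sigma> and constant increment, so
  no case distinction between \<sigma> below and above 1 arises.\<close>

lemma restr_restr [simp]: "restr X (restr X v) = restr X v"
  by (auto simp: restr_def fun_eq_iff)

lemma restr_restr_subset: "X \<subseteq> Y \<Longrightarrow> restr X (restr Y v) = restr X v"
  by (auto simp: restr_def fun_eq_iff)

lemma restr_in_funs_on [simp]: "restr X v \<in> funs_on X"
  by (auto simp: restr_def funs_on_def)

lemma restr_funs_on: "v \<in> funs_on X \<Longrightarrow> restr X v = v"
  by (auto simp: restr_def funs_on_def fun_eq_iff)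

lemma funs_on_mono: "X \<subseteq> Y \<Longrightarrow> funs_on X \<subseteq> funs_on Y"
  by (auto simp: funs_on_def)

lemma block_in_funs_on [simp]: "block X Y L v \<in> funs_on X"
  by (simp add: block_def)

lemma block_restr: "Y \<subseteq> Z \<Longrightarrow> block X Y L (restr Z v) = block X Y L v"
  by (simp add: block_def restr_restr_subset)

lemma restr_add: "restr X (v + w) = restr X v + restr X (w :: 'a \<Rightarrow> 'b::monoid_add)"
  by (auto simp: restr_def fun_eq_iff)

lemma restr_diff: "restr X (v - w) = restr X v - restr X (w :: 'a \<Rightarrow> 'b::group_add)"
  by (auto simp: restr_def fun_eq_iff)

lemma restr_scaleR:
  "restr X (\<lambda>\<xi>. c *\<^sub>R v \<xi>) = (\<lambda>\<xi>. c *\<^sub>R restr X (v :: 'a \<Rightarrow> 'b::real_vector) \<xi>)"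
  by (auto simp: restr_def fun_eq_iff)

lemma restr_finite_support: "finite X \<Longrightarrow> finitely_supported (restr X v)"
  unfolding finitely_supported_def restr_def by (rule finite_subset[of _ X]) auto

lemma linear_spaceD:
  assumes "linear_space V"
  shows "0 \<in> V" "v \<in> V \<Longrightarrow> w \<in> V \<Longrightarrow> v + w \<in> V" "v \<in> V \<Longrightarrow> (\<lambda>\<xi>. c *\<^sub>R v \<xi>) \<in> V"
  using assms by (auto simp: linear_space_def)

lemma linear_space_uminus: "linear_space V \<Longrightarrow> v \<in> V \<Longrightarrow> - v \<in> V"
  using linear_spaceD(3)[of V v "-1"] by (simp add: fun_Compl_def)

lemma linear_space_diff: "linear_space V \<Longrightarrow> v \<in> V \<Longrightarrow> w \<in> V \<Longrightarrow> v - w \<in> V"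
  using linear_spaceD(2)[of V v "- w"] linear_space_uminus[of V w] by simp

lemma linear_space_funs_on: "linear_space (funs_on X)"
  by (auto simp: linear_space_def funs_on_def)

lemma linear_space_Int: "linear_space V \<Longrightarrow> linear_space W \<Longrightarrow> linear_space (V \<inter> W)"
  by (auto simp: linear_space_def)

text \<open>Linearity is relative to a set because operators built with \<open>inv_into\<close> are
  unspecified off the image; \<open>Schur_inv P\<close>, for example, is linear on
  \<open>force P\<close>.\<close>

definition rlinear_on ::
  "('a \<Rightarrow> 'b::real_vector) set \<Rightarrow> (('a \<Rightarrow> 'b) \<Rightarrow> 'c \<Rightarrow> 'e::real_vector) \<Rightarrow> bool" where
  "rlinear_on V B \<longleftrightarrow>
     (\<forall>v\<in>V. \<forall>w\<in>V. B (v + w) = B v + B w) \<and>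
     (\<forall>c. \<forall>v\<in>V. B (\<lambda>\<xi>. c *\<^sub>R v \<xi>) = (\<lambda>\<xi>. c *\<^sub>R B v \<xi>))"

lemma rlinear_onD:
  assumes "rlinear_on V B"
  shows "v \<in> V \<Longrightarrow> w \<in> V \<Longrightarrow> B (v + w) = B v + B w"
    and "v \<in> V \<Longrightarrow> B (\<lambda>\<xi>. c *\<^sub>R v \<xi>) = (\<lambda>\<xi>. c *\<^sub>R B v \<xi>)"
  using assms by (auto simp: rlinear_on_def)

lemma rlinear_on_uminus: "rlinear_on V B \<Longrightarrow> v \<in> V \<Longrightarrow> B (- v) = - B v"
  using rlinear_onD(2)[of V B v "-1"] by (simp add: fun_Compl_def)

lemma rlinear_on_diff:
  "rlinear_on V B \<Longrightarrow> linear_space V \<Longrightarrow> v \<in> V \<Longrightarrow> w \<in> V \<Longrightarrow> B (v - w) = B v - B w"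
  using rlinear_onD(1)[of V B v "- w"] linear_space_uminus[of V w] rlinear_on_uminus[of V B w]
  by simp

lemma rlinear_on_zero: "rlinear_on V B \<Longrightarrow> linear_space V \<Longrightarrow> B 0 = 0"
  using rlinear_on_diff[of V B 0 0] linear_spaceD(1)[of V] by simp

lemma rlinear_on_minus_fun:
  "rlinear_on V A \<Longrightarrow> rlinear_on V B \<Longrightarrow> rlinear_on V (\<lambda>v. A v - B v)"
  unfolding rlinear_on_def by (auto simp: fun_eq_iff algebra_simps)

lemma rlinear_on_add_fun:
  "rlinear_on V A \<Longrightarrow> rlinear_on V B \<Longrightarrow> rlinear_on V (\<lambda>v. A v + B v)"
  unfolding rlinear_on_def by (auto simp: fun_eq_iff algebra_simps)

lemma rlinear_on_uminus_fun: "rlinear_on V A \<Longrightarrow> rlinear_on V (\<lambda>v. - A v)"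
  unfolding rlinear_on_def by (auto simp: fun_eq_iff algebra_simps)

lemma rlinear_on_compose:
  "rlinear_on V B \<Longrightarrow> rlinear_on F A \<Longrightarrow> (\<And>v. v \<in> V \<Longrightarrow> B v \<in> F) \<Longrightarrow> rlinear_on V (\<lambda>v. A (B v))"
  unfolding rlinear_on_def by auto

lemma rlinear_on_restr: "rlinear_on V (restr X)"
  unfolding rlinear_on_def by (simp add: restr_add restr_scaleR)

lemma rlinear_on_block: "rlinear_on UNIV L \<Longrightarrow> rlinear_on V (block X Y L)"
  unfolding rlinear_on_def block_def by (simp add: restr_add restr_scaleR)

lemma rlinear_on_inv_into:
  assumes V: "linear_space V" and B: "rlinear_on V B" and bij: "bij_betw B V F"
  shows "rlinear_on F (inv_into V B)"
proof -
  have inj: "inj_on B V" and img: "B ` V = F"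
    using bij by (auto simp: bij_betw_def)
  show ?thesis
    unfolding rlinear_on_def
  proof (intro conjI ballI allI)
    fix f g assume "f \<in> F" "g \<in> F"
    then obtain v w where "v \<in> V" "w \<in> V" "f = B v" "g = B w" using img by blast
    then show "inv_into V B (f + g) = inv_into V B f + inv_into V B g"
      using inv_into_f_f[OF inj] rlinear_onD(1)[OF B] linear_spaceD(2)[OF V] by metis
  next
    fix c f assume "f \<in> F"
    then obtain v where v: "v \<in> V" "f = B v" using img by blast
    have "inv_into V B (B (\<lambda>\<xi>. c *\<^sub>R v \<xi>)) = (\<lambda>\<xi>. c *\<^sub>R v \<xi>)"
      using v V by (intro inv_into_f_f[OF inj]) (auto simp: linear_spaceD)
    then show "inv_into V B (\<lambda>\<xi>. c *\<^sub>R f \<xi>) = (\<lambda>\<xi>. c *\<^sub>R inv_into V B f \<xi>)"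
      using v inv_into_f_f[OF inj] rlinear_onD(2)[OF B] by simp
  qed
qed


subsection \<open>Complexification\<close>

definition of_real_fun :: "('a \<Rightarrow> real^'d) \<Rightarrow> 'a \<Rightarrow> complex^'d" where
  "of_real_fun v = (\<lambda>\<xi>. \<chi> i. complex_of_real (v \<xi> $ i))"

lemma re_part_simps [simp]:
  "re_part (v + w) = re_part v + re_part w"
  "re_part (v - w) = re_part v - re_part w"
  "re_part 0 = 0"
  "re_part (restr X w) = restr X (re_part w)"
  "re_part (cop B w) = B (re_part w)"
  "re_part (of_real_fun x) = x"
  by (auto simp: re_part_def restr_def cop_def of_real_fun_def fun_eq_iff vec_eq_iff)

lemma im_part_simps [simp]:
  "im_part (v + w) = im_part v + im_part w"
  "im_part (v - w) = im_part v - im_part w"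
  "im_part 0 = 0"
  "im_part (restr X w) = restr X (im_part w)"
  "im_part (cop B w) = B (im_part w)"
  "im_part (of_real_fun x) = 0"
  by (auto simp: im_part_def restr_def cop_def of_real_fun_def fun_eq_iff vec_eq_iff)

lemma re_part_scale:
  "re_part (\<lambda>\<xi>. c *s w \<xi>) = (\<lambda>\<xi>. Re c *\<^sub>R re_part w \<xi>) - (\<lambda>\<xi>. Im c *\<^sub>R im_part w \<xi>)"
  by (auto simp: re_part_def im_part_def fun_eq_iff vec_eq_iff)

lemma im_part_scale:
  "im_part (\<lambda>\<xi>. c *s w \<xi>) = (\<lambda>\<xi>. Re c *\<^sub>R im_part w \<xi>) + (\<lambda>\<xi>. Im c *\<^sub>R re_part w \<xi>)"
  by (auto simp: re_part_def im_part_def fun_eq_iff vec_eq_iff)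

lemma complex_fun_eqI: "re_part v = re_part w \<Longrightarrow> im_part v = im_part w \<Longrightarrow> v = w"
  by (auto simp: re_part_def im_part_def fun_eq_iff vec_eq_iff complex_eq_iff)

text \<open>\<open>cop B\<close> also applies \<open>B\<close> to the imaginary part, which is zero
  here; the premise keeps it zero.\<close>

lemma cop_of_real_fun: "B 0 = 0 \<Longrightarrow> cop B (of_real_fun v) = of_real_fun (B v)"
  by (rule complex_fun_eqI) auto

lemma of_real_fun_diff: "of_real_fun (v - w) = of_real_fun v - of_real_fun w"
  by (rule complex_fun_eqI) auto

lemma cop_block: "cop (block X Y B) = block X Y (cop B)"
  unfolding block_def fun_eq_iff[of "cop _"] by (auto intro!: complex_fun_eqI)

lemma cspace_funs_on: "cspace (funs_on X) = funs_on X"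
  by (auto simp: cspace_def funs_on_def re_part_def im_part_def vec_eq_iff complex_eq_iff)

lemma cspace_mono: "V \<subseteq> W \<Longrightarrow> cspace V \<subseteq> cspace W"
  by (auto simp: cspace_def)

definition clinear_space :: "('a \<Rightarrow> complex^'d) set \<Rightarrow> bool" where
  "clinear_space W \<longleftrightarrow>
     0 \<in> W \<and> (\<forall>v\<in>W. \<forall>w\<in>W. v + w \<in> W) \<and> (\<forall>c. \<forall>w\<in>W. (\<lambda>\<xi>. c *s w \<xi>) \<in> W)"

lemma clinear_spaceD:
  assumes "clinear_space W"
  shows "0 \<in> W" "v \<in> W \<Longrightarrow> w \<in> W \<Longrightarrow> v + w \<in> W" "w \<in> W \<Longrightarrow> (\<lambda>\<xi>. c *s w \<xi>) \<in> W"
  using assms by (auto simp: clinear_space_def)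

lemma clinear_space_diff:
  assumes "clinear_space W" "v \<in> W" "w \<in> W"
  shows "v - w \<in> W"
proof -
  have "v - w = v + (\<lambda>\<xi>. (-1) *s w \<xi>)" by (auto simp: fun_eq_iff vec_eq_iff)
  then show ?thesis
    using clinear_spaceD(2)[OF assms(1,2) clinear_spaceD(3)[OF assms(1,3)]] by metis
qed

lemma clinear_space_cspace: "linear_space V \<Longrightarrow> clinear_space (cspace V)"
  unfolding clinear_space_def cspace_def
  by (auto simp: re_part_scale im_part_scale linear_spaceD linear_space_diff)

lemma clinear_space_funs_on: "clinear_space (funs_on X)"
  by (auto simp: clinear_space_def funs_on_def)

lemma clinear_on_cop:
  assumes V: "linear_space V" and B: "rlinear_on V B"
  shows "clinear_on (cspace V) (cop B)"
  unfolding clinear_on_def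
proof (intro conjI ballI allI)
  fix v w assume "v \<in> cspace V" "w \<in> cspace V"
  then show "cop B (v + w) = cop B v + cop B w"
    by (intro complex_fun_eqI) (auto simp: cspace_def rlinear_onD[OF B])
next
  fix c w assume "w \<in> cspace V"
  then show "cop B (\<lambda>\<xi>. c *s w \<xi>) = (\<lambda>\<xi>. c *s cop B w \<xi>)"
    by (intro complex_fun_eqI)
      (auto simp: cspace_def re_part_scale im_part_scale rlinear_onD[OF B]
        rlinear_on_diff[OF B V] linear_spaceD[OF V])
qed

lemma clinear_on_diff:
  assumes "clinear_on W Q" "clinear_space W" "v \<in> W" "w \<in> W"
  shows "Q (v - w) = Q v - Q w"
proof -
  have eq: "v - w = v + (\<lambda>\<xi>. (-1) *s w \<xi>)" for v w :: "'a \<Rightarrow> complex^'b"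
    by (auto simp: fun_eq_iff vec_eq_iff)
  show ?thesis
    unfolding eq[of v w] eq[of "Q v" "Q w"]
    using assms(1,3,4) clinear_spaceD(3)[OF assms(2,4)] unfolding clinear_on_def by metis
qed

lemma clinear_on_zero: "clinear_on W Q \<Longrightarrow> clinear_space W \<Longrightarrow> Q 0 = 0"
  using clinear_on_diff[of W Q 0 0] by (simp add: clinear_space_def)

section \<open>Finite-dimensional linear algebra of complex functions on a finite set of
  sites\<close>

definition unit_fun :: "'a \<Rightarrow> 'd \<Rightarrow> 'a \<Rightarrow> complex^'d" where
  "unit_fun \<xi> i = (\<lambda>\<eta>. \<chi> j. if \<eta> = \<xi> \<and> j = i then 1 else 0)"

lemma unit_fun_nonzero: "unit_fun \<xi> i \<noteq> (0 :: 'a \<Rightarrow> complex^'d)"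
proof
  assume "unit_fun \<xi> i = (0 :: 'a \<Rightarrow> complex^'d)"
  then have "unit_fun \<xi> i \<xi> $ i = (0 :: complex)" by simp
  then show False by (simp add: unit_fun_def)
qed

lemma unit_fun_in_funs_on: "\<xi> \<in> X \<Longrightarrow> unit_fun \<xi> i \<in> funs_on X"
  by (auto simp: unit_fun_def funs_on_def vec_eq_iff)

interpretation cfun: vector_space "\<lambda>c (w :: 'a \<Rightarrow> complex^'d) \<xi>. c *s w \<xi>"
  by unfold_locales (auto simp: fun_eq_iff vec_eq_iff algebra_simps)

interpretation cfun_pair: vector_space_pair "\<lambda>c (w :: 'a \<Rightarrow> complex^'d) \<xi>. c *s w \<xi>"
  "\<lambda>c (w :: 'a \<Rightarrow> complex^'d) \<xi>. c *s w \<xi>"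
  by unfold_locales

lemma funs_on_expansion:
  assumes "finite X" "w \<in> funs_on X"
  shows "w = (\<Sum>(\<eta>, j)\<in>X \<times> UNIV. (\<lambda>\<xi>. w \<eta> $ j *s unit_fun \<eta> j \<xi>))"
proof (rule ext, subst vec_eq_iff, rule allI)
  fix \<xi> i
  have eq: "(\<Sum>p\<in>A. f p) \<xi> $ i = (\<Sum>p\<in>A. f p \<xi> $ i)"
    for A and f :: "'a \<times> 'b \<Rightarrow> 'a \<Rightarrow> complex^'b"
    by (induction A rule: infinite_finite_induct) auto
  have "(\<Sum>p\<in>X \<times> UNIV. (case p of (\<eta>, j) \<Rightarrow> \<lambda>\<xi>. w \<eta> $ j *s unit_fun \<eta> j \<xi>) \<xi> $ i)
      = (\<Sum>p\<in>X \<times> UNIV. if p = (\<xi>, i) then w \<xi> $ i else 0)"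
    by (rule sum.cong) (auto simp: unit_fun_def split: if_splits)
  also have "\<dots> = w \<xi> $ i"
    using assms by (auto simp: funs_on_def)
  finally show "w \<xi> $ i = (\<Sum>(\<eta>, j)\<in>X \<times> UNIV. (\<lambda>\<xi>. w \<eta> $ j *s unit_fun \<eta> j \<xi>)) \<xi> $ i"
    unfolding eq by simp
qed

lemma span_unit_fun:
  fixes X :: "'a set"
  assumes "finite X"
  shows "cfun.span ((\<lambda>(\<eta>, j). unit_fun \<eta> j) ` (X \<times> UNIV)) = (funs_on X :: ('a \<Rightarrow> complex^'d) set)"
    (is "cfun.span ?E = _")
proof
  show "cfun.span ?E \<subseteq> funs_on X"
    by (rule cfun.span_minimal)
      (auto simp: unit_fun_in_funs_on cfun.subspace_def, auto simp: funs_on_def)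
  show "funs_on X \<subseteq> cfun.span ?E"
  proof
    fix w :: "'a \<Rightarrow> complex^'d" assume w: "w \<in> funs_on X"
    have "(\<Sum>(\<eta>, j)\<in>X \<times> UNIV. (\<lambda>\<xi>. w \<eta> $ j *s unit_fun \<eta> j \<xi>)) \<in> cfun.span ?E"
      by (intro cfun.span_sum, clarify, rule cfun.span_scale, rule cfun.span_base) auto
    then show "w \<in> cfun.span ?E"
      using funs_on_expansion[OF assms w] by simp
  qed
qed

text \<open>The theory of bases speaks of maps that are linear on the whole type, whereas
  \<open>B\<close> is linear on \<open>funs_on X\<close> only. The extension is built from the
  values of \<open>B\<close> on a basis; the set where both maps agree is a subspace containing that
  basis.\<close>

lemma clinear_on_total:
  fixes X :: "'a set" and B :: "('a \<Rightarrow> complex^'d) \<Rightarrow> 'a \<Rightarrow> complex^'d"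
  assumes "clinear_on (funs_on X) B" and "finite X"
  obtains g where "Vector_Spaces.linear (\<lambda>c w \<xi>. c *s w \<xi>) (\<lambda>c w \<xi>. c *s w \<xi>) g"
    and "\<And>w. w \<in> funs_on X \<Longrightarrow> g w = B w"
proof -
  obtain S :: "('a \<Rightarrow> complex^'d) set"
    where S: "cfun.independent S" "cfun.span S = funs_on X"
    by (metis cfun.basis_exists cfun.span_subspace cfun.subspace_span
        span_unit_fun[OF assms(2)])
  obtain g where g: "Vector_Spaces.linear (\<lambda>c w \<xi>. c *s w \<xi>) (\<lambda>c w \<xi>. c *s w \<xi>) g"
    "\<forall>x\<in>S. g x = B x"
    using cfun_pair.linear_independent_extend[OF S(1), of B] by blast
  have "cfun.span S \<subseteq> {w \<in> funs_on X. g w = B w}"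
  proof (rule cfun.span_minimal)
    show "S \<subseteq> {w \<in> funs_on X. g w = B w}"
      using g(2) S(2) cfun.span_superset by auto
    have "g 0 = B 0"
      using cfun_pair.linear_0[OF g(1)] clinear_on_zero[OF assms(1) clinear_space_funs_on] by simp
    then show "cfun.subspace {w \<in> funs_on X. g w = B w}"
      using assms(1) clinear_space_funs_on[of X]
      by (auto simp: cfun.subspace_def clinear_space_def clinear_on_def
        cfun_pair.linear_add[OF g(1)] cfun_pair.linear_scale[OF g(1)])
  qed
  with g(1) S(2) that show ?thesis by blast
qed

text \<open>Dimension count: an injective map sends a basis \<open>S\<close> to an independent set
  of equal size. A missed \<open>y\<close> could be added to it, giving more independent vectors in
  the span of \<open>S\<close> than \<open>S\<close> has elements.\<close>

lemma clinear_on_inj_imp_surj: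
  fixes X :: "'a set" and B :: "('a \<Rightarrow> complex^'d) \<Rightarrow> 'a \<Rightarrow> complex^'d"
  assumes B: "clinear_on (funs_on X) B" and X: "finite X"
    and maps: "\<And>w. w \<in> funs_on X \<Longrightarrow> B w \<in> funs_on X"
    and inj: "inj_on B (funs_on X)"
  shows "B ` funs_on X = funs_on X"
proof (rule ccontr)
  assume neq: "B ` funs_on X \<noteq> funs_on X"
  define E where "E = (\<lambda>(\<eta>, j). unit_fun \<eta> j :: 'a \<Rightarrow> complex^'d) ` (X \<times> UNIV)"
  have E: "finite E" "cfun.span E = funs_on X"
    using X span_unit_fun[OF X] by (auto simp: E_def)
  obtain S :: "('a \<Rightarrow> complex^'d) set"
    where S: "S \<subseteq> funs_on X" "cfun.independent S" "cfun.span S = funs_on X"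
    by (metis cfun.basis_exists cfun.span_subspace cfun.subspace_span E(2))
  obtain g where g: "Vector_Spaces.linear (\<lambda>c w \<xi>. c *s w \<xi>) (\<lambda>c w \<xi>. c *s w \<xi>) g"
    "\<And>w. w \<in> funs_on X \<Longrightarrow> g w = B w"
    using clinear_on_total[OF B X] by metis
  have gB: "g ` funs_on X = B ` funs_on X" using g(2) by auto
  have gi: "inj_on g (funs_on X)"
    using inj g(2) by (auto simp: inj_on_def)
  have ind: "cfun.independent (g ` S)"
    using cfun_pair.linear_independent_injective_image[OF g(1) S(2)] gi S(3) by simp
  have sp: "cfun.span (g ` S) = B ` funs_on X"
    using cfun_pair.linear_span_image[OF g(1), of S] S(3) gB by simp
  obtain y where y: "y \<in> funs_on X" "y \<notin> cfun.span (g ` S)"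
    using neq maps sp by auto
  have finS: "finite S" using cfun.independent_span_bound[OF E(1) S(2)] S(1) E(2) by auto
  have card: "card (g ` S) = card S"
    using gi S(1) by (intro card_image) (auto intro: inj_on_subset)
  have "cfun.independent (insert y (g ` S))"
    using ind y(2) by (simp add: cfun.independent_insert)
  moreover have "insert y (g ` S) \<subseteq> cfun.span S"
    using y(1) S g(2) maps by auto
  ultimately have "card (insert y (g ` S)) \<le> card S"
    using cfun.independent_span_bound[OF finS] by blast
  moreover have "y \<notin> g ` S" using y(2) cfun.span_base[of y "g ` S"] by metis
  ultimately show False using card finS by simp
qed


subsection \<open>Spectra\<close>

lemma bij_betw_self_iff:
  assumes "\<And>a. a \<in> A \<Longrightarrow> f a \<in> A"
  shows "bij_betw f A A \<longleftrightarrow> (\<forall>b\<in>A. \<exists>!a. a \<in> A \<and> f a = b)"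
proof
  assume "bij_betw f A A"
  then have "inj_on f A" "f ` A = A" by (auto simp: bij_betw_def)
  then show "\<forall>b\<in>A. \<exists>!a. a \<in> A \<and> f a = b" by (metis imageE inj_onD)
next
  assume ex1: "\<forall>b\<in>A. \<exists>!a. a \<in> A \<and> f a = b"
  have "inj_on f A" by (rule inj_onI) (use ex1 assms in metis)
  moreover have "A \<subseteq> f ` A" using ex1 by blast
  ultimately show "bij_betw f A A" using assms by (auto simp: bij_betw_def)
qed

text \<open>Infinite sets have \<open>card\<close> equal to \<open>0\<close>, so \<open>card\<close>
  detects singletons. This turns unique solvability into a quantity that bijections
  preserve.\<close>

lemma ex1_in_iff_card: "(\<exists>!a. a \<in> A) \<longleftrightarrow> card A = Suc 0"
  by (auto simp: card_1_singleton_iff)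

lemma bij_betw_ex1_iff:
  assumes "bij_betw f A B"
  shows "(\<exists>!a. a \<in> A) \<longleftrightarrow> (\<exists>!b. b \<in> B)"
  by (simp only: ex1_in_iff_card bij_betw_same_card[OF assms])

text \<open>
  If \<open>T\<close> factors through the restriction \<open>R\<close> to \<open>X\<close>, then \<open>w \<mapsto> R w\<close> and \<open>u \<mapsto> (T u - g) / z\<close> are
  inverse bijections between the solutions of \<open>T w - z w = g\<close> and of \<open>R T u - z u = R g\<close>.
\<close>

lemma op_spectrum_block:
  fixes X :: "'a set" and T :: "('a \<Rightarrow> complex^'d) \<Rightarrow> 'a \<Rightarrow> complex^'d"
  assumes W: "clinear_space W" and maps: "\<And>w. w \<in> W \<Longrightarrow> T w \<in> W"
    and X: "funs_on X \<subseteq> W" and TR: "\<And>w. w \<in> W \<Longrightarrow> T (restr X w) = T w"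
    and z: "z \<noteq> 0"
  shows "z \<in> op_spectrum W T \<longleftrightarrow> z \<in> op_spectrum (funs_on X) (block X X T)"
proof -
  let ?U = "funs_on X :: ('a \<Rightarrow> complex^'d) set"
  define sc where "sc c w = (\<lambda>\<xi>. c *s (w \<xi> :: complex^'d))" for c and w :: "'a \<Rightarrow> complex^'d"
  have scW: "sc c w \<in> W" if "w \<in> W" for c w
    using clinear_spaceD(3)[OF W that] by (simp add: sc_def)
  have sc_inv: "sc (1 / z) (sc z w) = w" "sc z (sc (1 / z) w) = w" for w
    using z by (auto simp: sc_def)
  have rsc: "restr X (sc c w) = sc c (restr X w)" for c w
    by (auto simp: sc_def restr_def fun_eq_iff vec_eq_iff)
  define S where "S g = {w \<in> W. T w - sc z w = g}" for g
  define S' where "S' h = {u \<in> ?U. block X X T u - sc z u = h}" for h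
  define lift where "lift g u = sc (1 / z) (T u - g)" for g u
  have blk: "block X X T u = restr X (T u)" if "u \<in> ?U" for u
    using that by (simp add: block_def restr_funs_on)
  have bij: "bij_betw (restr X) (S g) (S' (restr X g))" if g: "g \<in> W" for g
  proof (rule bij_betw_byWitness[where f' = "lift g"])
    show "\<forall>w\<in>S g. lift g (restr X w) = w"
    proof
      fix w assume "w \<in> S g"
      then have "w \<in> W" "T w - g = sc z w" by (auto simp: S_def)
      then show "lift g (restr X w) = w"
        by (simp add: lift_def TR sc_inv del: minus_apply)
    qed
    have *: "restr X (lift g u) = u" "T (lift g u) - sc z (lift g u) = g" "lift g u \<in> W"
      if "u \<in> S' (restr X g)" for u
    proof -
      have u: "u \<in> ?U" "restr X (T u) - sc z u = restr X g"
        using that blk by (auto simp: S'_def)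
      show m: "lift g u \<in> W"
        using u(1) X maps g W by (auto simp: lift_def intro!: scW clinear_space_diff)
      have "restr X (T u) - restr X g = sc z u" unfolding u(2)[symmetric] by simp
      then show r: "restr X (lift g u) = u"
        by (simp add: lift_def rsc restr_diff sc_inv del: minus_apply)
      have "T (lift g u) = T u" using TR[OF m] r by simp
      then show "T (lift g u) - sc z (lift g u) = g"
        by (simp add: lift_def sc_inv)
    qed
    show "\<forall>u\<in>S' (restr X g). restr X (lift g u) = u" using * by blast
    show "lift g ` S' (restr X g) \<subseteq> S g" using * by (auto simp: S_def)
    show "restr X ` S g \<subseteq> S' (restr X g)"
      by (auto simp: S_def S'_def blk TR restr_diff rsc)
  qed
  have ex1: "(\<exists>!w. w \<in> S g) \<longleftrightarrow> (\<exists>!u. u \<in> S' (restr X g))" if "g \<in> W" for g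
    by (rule bij_betw_ex1_iff[OF bij[OF that]])
  have "bij_betw (\<lambda>w. T w - sc z w) W W \<longleftrightarrow> (\<forall>g\<in>W. \<exists>!w. w \<in> S g)"
    by (subst bij_betw_self_iff) (auto simp: S_def maps scW W clinear_space_diff)
  \<comment> \<open>Right-hand sides correspond as well: each \<open>h\<close> in \<open>?U\<close>
    lies in \<open>W\<close> and is its own restriction, so \<open>restr X\<close> reaches all of
    \<open>?U\<close>.\<close>
  also have "\<dots> \<longleftrightarrow> (\<forall>h\<in>?U. \<exists>!u. u \<in> S' h)"
  proof
    assume ex: "\<forall>g\<in>W. \<exists>!w. w \<in> S g"
    show "\<forall>h\<in>?U. \<exists>!u. u \<in> S' h"
    proof
      fix h assume h: "h \<in> ?U"
      then have "h \<in> W" using X by blast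
      with ex have "\<exists>!w. w \<in> S h" by blast
      then show "\<exists>!u. u \<in> S' h"
        using ex1[OF \<open>h \<in> W\<close>] restr_funs_on[OF h] by simp
    qed
  next
    assume "\<forall>h\<in>?U. \<exists>!u. u \<in> S' h"
    then show "\<forall>g\<in>W. \<exists>!w. w \<in> S g" using ex1 by simp
  qed
  also have "\<dots> \<longleftrightarrow> bij_betw (\<lambda>u. block X X T u - sc z u) ?U ?U"
  proof (subst bij_betw_self_iff)
    show "block X X T u - sc z u \<in> ?U" if "u \<in> ?U" for u
      using that clinear_spaceD(3)[OF clinear_space_funs_on that, of z]
      by (intro clinear_space_diff[OF clinear_space_funs_on]) (auto simp: sc_def)
  qed (auto simp: S'_def)
  finally show ?thesis by (simp add: op_spectrum_def sc_def)
qed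

text \<open>The two spectra agree away from \<open>0\<close>, and \<open>0\<close> is inserted
  before taking the supremum. The second claim is what later makes that supremum meaningful: it
  moves boundedness from the block to the full operator.\<close>

lemma op_spectral_radius_block:
  fixes X :: "'a set" and T :: "('a \<Rightarrow> complex^'d) \<Rightarrow> 'a \<Rightarrow> complex^'d"
  assumes "clinear_space W" "\<And>w. w \<in> W \<Longrightarrow> T w \<in> W"
    and "funs_on X \<subseteq> W" "\<And>w. w \<in> W \<Longrightarrow> T (restr X w) = T w"
  shows "op_spectral_radius W T = op_spectral_radius (funs_on X) (block X X T)"
    and "bdd_above (cmod ` op_spectrum W T) \<longleftrightarrow>
      bdd_above (cmod ` op_spectrum (funs_on X) (block X X T))"
proof -
  let ?A = "op_spectrum W T" and ?B = "op_spectrum (funs_on X) (block X X T)"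
  have "insert 0 ?A = insert 0 ?B"
    using op_spectrum_block[of W T X] assms by blast
  then have "cmod ` insert 0 ?A = cmod ` insert 0 ?B" by (rule arg_cong)
  then have eq: "insert 0 (cmod ` ?A) = insert 0 (cmod ` ?B)" by (simp only: image_insert norm_zero)
  then show "op_spectral_radius W T = op_spectral_radius (funs_on X) (block X X T)"
    by (simp only: op_spectral_radius_def)
  have "bdd_above (insert 0 (cmod ` ?A)) \<longleftrightarrow> bdd_above (insert 0 (cmod ` ?B))"
    by (simp only: eq)
  then show "bdd_above (cmod ` ?A) \<longleftrightarrow> bdd_above (cmod ` ?B)"
    by simp
qed

text \<open>If \<open>cmod z\<close> exceeds an operator bound \<open>C\<close>, a kernel vector
  \<open>w\<close> of \<open>B - z\<close> satisfies \<open>cmod z * N w \<le> C * N w\<close>,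
  hence vanishes. In finite dimension injectivity already gives bijectivity, so \<open>z\<close> is
  outside the spectrum. The sum norm \<open>N\<close> of the coordinates is chosen because its
  operator bound can be read off the unit functions.\<close>

lemma bdd_above_op_spectrum:
  fixes X :: "'a set" and B :: "('a \<Rightarrow> complex^'d) \<Rightarrow> 'a \<Rightarrow> complex^'d"
  assumes X: "finite X" and B: "clinear_on (funs_on X) B"
    and maps: "\<And>w. w \<in> funs_on X \<Longrightarrow> B w \<in> funs_on X"
  shows "bdd_above (cmod ` op_spectrum (funs_on X) B)"
proof -
  define sc where "sc c w = (\<lambda>\<xi>. c *s (w \<xi> :: complex^'d))" for c and w :: "'a \<Rightarrow> complex^'d"
  define I :: "('a \<times> 'd) set" where "I = X \<times> UNIV"
  have I: "finite I" using X by (simp add: I_def)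
  define N where "N w = (\<Sum>(\<eta>, j)\<in>I. cmod (w \<eta> $ j))" for w
  have N_sc: "N (sc c w) = cmod c * N w" for c w
    by (simp add: N_def sc_def norm_mult sum_distrib_left case_prod_unfold)
  have N_add: "N (v + w) \<le> N v + N w" for v w
    unfolding N_def sum.distrib[symmetric] case_prod_unfold
    by (rule sum_mono) (simp add: norm_triangle_ineq)
  have N_sum: "N (\<Sum>p\<in>A. f p) \<le> (\<Sum>p\<in>A. N (f p))" for A and f :: "'a \<times> 'd \<Rightarrow> 'a \<Rightarrow> complex^'d"
  proof (induction A rule: infinite_finite_induct)
    case (insert p A)
    have "N (\<Sum>p\<in>insert p A. f p) \<le> N (f p) + N (\<Sum>p\<in>A. f p)"
      unfolding sum.insert[OF insert(1,2)] by (rule N_add)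
    also have "\<dots> \<le> (\<Sum>p\<in>insert p A. N (f p))"
      unfolding sum.insert[OF insert(1,2)] using insert(3) by simp
    finally show ?case .
  qed (simp_all add: N_def)
  have N_0: "w = 0" if "w \<in> funs_on X" "N w \<le> 0" for w
  proof -
    have "N w = 0" using that(2) by (intro antisym) (auto simp: N_def intro!: sum_nonneg)
    then have "\<forall>\<eta>\<in>X. w \<eta> = 0"
      using I by (auto simp: N_def I_def sum_nonneg_eq_0_iff case_prod_unfold vec_eq_iff)
    with that(1) show ?thesis by (auto simp: funs_on_def fun_eq_iff)
  qed
  obtain g where g: "Vector_Spaces.linear (\<lambda>c w \<xi>. c *s w \<xi>) (\<lambda>c w \<xi>. c *s w \<xi>) g"
    "\<And>w. w \<in> funs_on X \<Longrightarrow> g w = B w"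
    using clinear_on_total[OF B X] by metis
  \<comment> \<open>The sum dominates each single term and, unlike a maximum, needs no separate
    treatment of empty \<open>X\<close>.\<close>
  define C where "C = (\<Sum>(\<eta>, j)\<in>I. N (g (unit_fun \<eta> j)))"
  have N_nonneg: "N w \<ge> 0" for w by (auto simp: N_def intro!: sum_nonneg)
  have N_B: "N (B w) \<le> C * N w" if w: "w \<in> funs_on X" for w
  proof -
    have "w = (\<Sum>p\<in>I. sc (w (fst p) $ snd p) (unit_fun (fst p) (snd p)))"
      using funs_on_expansion[OF X w] by (simp add: I_def sc_def case_prod_unfold)
    then have "g w = g (\<Sum>p\<in>I. sc (w (fst p) $ snd p) (unit_fun (fst p) (snd p)))"
      by (rule arg_cong)
    also have "\<dots> = (\<Sum>p\<in>I. sc (w (fst p) $ snd p) (g (unit_fun (fst p) (snd p))))"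
      by (simp add: cfun_pair.linear_sum[OF g(1)] sc_def cfun_pair.linear_scale[OF g(1)])
    finally have "N (B w) \<le> (\<Sum>p\<in>I. N (sc (w (fst p) $ snd p) (g (unit_fun (fst p) (snd p)))))"
      using N_sum g(2)[OF w] by simp
    also have "\<dots> = (\<Sum>p\<in>I. cmod (w (fst p) $ snd p) * N (g (unit_fun (fst p) (snd p))))"
      by (simp add: N_sc)
    also have "\<dots> \<le> (\<Sum>p\<in>I. cmod (w (fst p) $ snd p) * C)"
      unfolding C_def case_prod_unfold
      by (intro sum_mono mult_left_mono member_le_sum I) (auto simp: N_nonneg)
    also have "\<dots> = C * N w"
      by (simp add: N_def sum_distrib_left case_prod_unfold mult.commute)
    finally show ?thesis .
  qed
  have "cmod z \<le> C" if "z \<in> op_spectrum (funs_on X) B" for z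
  proof (rule ccontr)
    assume zC: "\<not> cmod z \<le> C"
    define f where "f w = B w - sc z w" for w
    have fmaps: "f w \<in> funs_on X" if "w \<in> funs_on X" for w
      using that clinear_spaceD(3)[OF clinear_space_funs_on that, of z] maps[OF that]
      unfolding f_def by (intro clinear_space_diff[OF clinear_space_funs_on]) (auto simp: sc_def)
    have flin: "clinear_on (funs_on X) f"
      using B unfolding clinear_on_def f_def sc_def
      by (simp add: fun_eq_iff vec_eq_iff algebra_simps)
    have "inj_on f (funs_on X)"
    proof (rule inj_onI)
      fix v w assume vw: "v \<in> funs_on X" "w \<in> funs_on X" "f v = f w"
      have d: "v - w \<in> funs_on X" using vw clinear_space_diff[OF clinear_space_funs_on] by blast
      have "f (v - w) = 0" using clinear_on_diff[OF flin clinear_space_funs_on vw(1,2)] vw(3) by simp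
      then have "cmod z * N (v - w) \<le> C * N (v - w)"
        using N_B[OF d] by (simp add: f_def N_sc)
      then have "(cmod z - C) * N (v - w) \<le> 0" by (simp add: algebra_simps)
      then have "N (v - w) \<le> 0" using zC by (simp add: mult_le_0_iff)
      then show "v = w" using N_0[OF d] by simp
    qed
    then have "bij_betw f (funs_on X) (funs_on X)"
      using clinear_on_inj_imp_surj[OF flin X fmaps] by (simp add: bij_betw_def)
    then show False using that by (simp add: op_spectrum_def f_def[abs_def] sc_def)
  qed
  then show ?thesis by (auto intro!: bdd_aboveI[where M = C])
qed

text \<open>\<open>Q\<close> applied to the unit function is an eigenvector for
  \<open>mu \<xi> $ i\<close>, nonzero because \<open>Q\<close> is injective with
  \<open>Q 0 = 0\<close>. The shifted operator thus takes the same value there and at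
  \<open>0\<close>, so the eigenvalue is in the spectrum; boundedness makes the supremum an upper
  bound.\<close>

lemma eigendecomposition_eigenvalue_le:
  fixes mu :: "'a \<Rightarrow> complex^'d"
  assumes W: "clinear_space W" and ed: "eigendecomposition W B Q mu"
    and bdd: "bdd_above (cmod ` op_spectrum W B)" and unit: "unit_fun \<xi> i \<in> W"
  shows "cmod (mu \<xi> $ i) \<le> op_spectral_radius W B"
proof -
  have Q: "clinear_on W Q" "bij_betw Q W W" "\<And>w. w \<in> W \<Longrightarrow> B w = Q (diag_op mu (inv_into W Q w))"
    using ed by (auto simp: eigendecomposition_def)
  let ?e = "unit_fun \<xi> i :: 'a \<Rightarrow> complex^'d"
  have inj: "inj_on Q W" and QW: "Q w \<in> W" if "w \<in> W" for w
    using Q(2) that by (auto simp: bij_betw_def)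
  have Q0: "Q 0 = 0" using clinear_on_zero[OF Q(1) W] .
  have zero: "0 \<in> W" using W by (rule clinear_spaceD)
  have "Q ?e \<noteq> Q 0"
    using inj_onD[OF inj[OF unit], of ?e 0] unit zero unit_fun_nonzero by metis
  have "diag_op mu ?e = (\<lambda>\<eta>. mu \<xi> $ i *s ?e \<eta>)"
    by (auto simp: diag_op_def unit_fun_def fun_eq_iff vec_eq_iff)
  then have "B (Q ?e) = (\<lambda>\<eta>. mu \<xi> $ i *s Q ?e \<eta>)"
    using Q(1) unit by (simp add: Q(3)[OF QW[OF unit]] inv_into_f_f[OF inj[OF unit]] clinear_on_def)
  moreover have "diag_op mu 0 = 0" by (auto simp: diag_op_def fun_eq_iff vec_eq_iff)
  then have "B 0 = 0"
    using Q(3)[OF zero] inv_into_f_f[OF inj[OF zero] zero] Q0 by simp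
  ultimately have "B (Q ?e) - (\<lambda>\<eta>. mu \<xi> $ i *s Q ?e \<eta>) = B 0 - (\<lambda>\<eta>. mu \<xi> $ i *s 0 \<eta>)"
    by (simp add: fun_eq_iff)
  then have "\<not> inj_on (\<lambda>w. B w - (\<lambda>\<eta>. mu \<xi> $ i *s w \<eta>)) W"
    using QW[OF unit] zero \<open>Q ?e \<noteq> Q 0\<close> Q0 unfolding inj_on_def by metis
  then have "mu \<xi> $ i \<in> op_spectrum W B"
    by (auto simp: op_spectrum_def bij_betw_def)
  then show ?thesis
    unfolding op_spectral_radius_def using bdd by (intro cSup_upper) auto
qed


subsection \<open>Square summable functions\<close>

lemma square_summable_L2_set_le:
  assumes "square_summable X v" "finite F" "F \<subseteq> X"
  shows "L2_set (\<lambda>\<xi>. norm (v \<xi>)) F \<le> l2norm X v"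
  unfolding L2_set_def l2norm_def using assms
  by (intro real_sqrt_le_mono finite_sum_le_infsum) (auto simp: square_summable_def)

text \<open>A uniform bound on finite partial norms yields summability and the norm estimate at
  once. The estimates below thereby reduce to inequalities for \<open>L2_set\<close> on finite
  sets.\<close>

lemma square_summableI_L2_set:
  assumes le: "\<And>F. finite F \<Longrightarrow> F \<subseteq> X \<Longrightarrow> L2_set (\<lambda>\<xi>. norm (v \<xi>)) F \<le> c"
  shows "square_summable X v" "l2norm X v \<le> c"
proof -
  \<comment> \<open>The empty partial sum shows that the bound is nonnegative.\<close>
  have c: "0 \<le> c" using le[of "{}"] by simp
  have sum_le: "(\<Sum>\<xi>\<in>F. (norm (v \<xi>))\<^sup>2) \<le> c\<^sup>2" if "finite F" "F \<subseteq> X" for F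
    using le[OF that] c by (simp add: L2_set_def sqrt_le_D)
  show s: "square_summable X v"
    unfolding square_summable_def
    by (rule nonneg_bdd_above_summable_on) (auto intro!: bdd_aboveI2[where M = "c\<^sup>2"] sum_le)
  have "(\<Sum>\<^sub>\<infinity>\<xi>\<in>X. (norm (v \<xi>))\<^sup>2) \<le> c\<^sup>2"
    using s sum_le unfolding square_summable_def by (intro infsum_le_finite_sums)
  then show "l2norm X v \<le> c"
    unfolding l2norm_def using c by (simp add: real_le_lsqrt)
qed

lemma l2norm_nonneg: "0 \<le> l2norm X v"
  by (auto simp: l2norm_def intro!: infsum_nonneg)

lemma l2norm_zero: "l2norm X 0 = 0"
  by (simp add: l2norm_def)

lemma square_summable_zero: "square_summable X 0"
  by (simp add: square_summable_def)

lemma l2norm_diff: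
  assumes "square_summable X v" "square_summable X w"
  shows "square_summable X (v - w)" "l2norm X (v - w) \<le> l2norm X v + l2norm X w"
proof -
  have *: "L2_set (\<lambda>\<xi>. norm ((v - w) \<xi>)) F \<le> l2norm X v + l2norm X w" if "finite F" "F \<subseteq> X" for F
  proof -
    have "L2_set (\<lambda>\<xi>. norm ((v - w) \<xi>)) F \<le> L2_set (\<lambda>\<xi>. norm (v \<xi>) + norm (w \<xi>)) F"
      by (rule L2_set_mono) (auto intro: norm_triangle_ineq4)
    also have "\<dots> \<le> L2_set (\<lambda>\<xi>. norm (v \<xi>)) F + L2_set (\<lambda>\<xi>. norm (w \<xi>)) F"
      by (rule L2_set_triangle_ineq)
    also have "\<dots> \<le> l2norm X v + l2norm X w"
      using square_summable_L2_set_le[OF assms(1) that] square_summable_L2_set_le[OF assms(2) that]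
      by simp
    finally show ?thesis .
  qed
  show "square_summable X (v - w)" "l2norm X (v - w) \<le> l2norm X v + l2norm X w"
    using square_summableI_L2_set[OF *] by blast+
qed

lemma l2norm_diag_op:
  assumes s: "0 \<le> s" and mu: "\<And>\<xi> i. \<xi> \<in> X \<Longrightarrow> cmod (mu \<xi> $ i) \<le> s"
    and w: "square_summable X w"
  shows "square_summable X (diag_op mu w)" "l2norm X (diag_op mu w) \<le> s * l2norm X w"
proof -
  have pointwise: "norm (diag_op mu w \<xi>) \<le> s * norm (w \<xi>)" if "\<xi> \<in> X" for \<xi>
  proof -
    have "norm (diag_op mu w \<xi>) \<le> L2_set (\<lambda>i. s * norm (w \<xi> $ i)) UNIV"
      unfolding norm_vec_def diag_op_def
      by (rule L2_set_mono) (auto simp: norm_mult mu[OF that] mult_right_mono)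
    also have "\<dots> = s * norm (w \<xi>)"
      unfolding norm_vec_def by (rule L2_set_right_distrib[OF s, symmetric])
    finally show ?thesis .
  qed
  have *: "L2_set (\<lambda>\<xi>. norm (diag_op mu w \<xi>)) F \<le> s * l2norm X w" if F: "finite F" "F \<subseteq> X" for F
  proof -
    have "L2_set (\<lambda>\<xi>. norm (diag_op mu w \<xi>)) F \<le> L2_set (\<lambda>\<xi>. s * norm (w \<xi>)) F"
      by (rule L2_set_mono) (use F pointwise in auto)
    also have "\<dots> = s * L2_set (\<lambda>\<xi>. norm (w \<xi>)) F"
      by (rule L2_set_right_distrib[OF s, symmetric])
    also have "\<dots> \<le> s * l2norm X w"
      using square_summable_L2_set_le[OF w F] s by (rule mult_left_mono)
    finally show ?thesis .
  qed
  show "square_summable X (diag_op mu w)" "l2norm X (diag_op mu w) \<le> s * l2norm X w"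
    using square_summableI_L2_set[OF *] by blast+
qed

text \<open>\<open>op_norm\<close> is a real supremum, so the quotients must be shown bounded before
  it can serve as an upper bound; \<open>l2_bounded\<close> supplies this.\<close>

lemma op_norm_bound:
  assumes bdd: "l2_bounded X V B" and zero: "0 \<in> V"
  shows "0 \<le> op_norm X V B"
    and "v \<in> V \<Longrightarrow> square_summable X v \<Longrightarrow> square_summable X (B v)"
    and "v \<in> V \<Longrightarrow> square_summable X v \<Longrightarrow> l2norm X (B v) \<le> op_norm X V B * l2norm X v"
proof -
  obtain C where C: "\<And>v. v \<in> V \<Longrightarrow> square_summable X v \<Longrightarrow>
      square_summable X (B v) \<and> l2norm X (B v) \<le> C * l2norm X v"
    using bdd by (auto simp: l2_bounded_def)
  let ?V = "{v \<in> V. square_summable X v}"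
  have "bdd_above ((\<lambda>v. l2norm X (B v) / l2norm X v) ` ?V)"
  proof (rule bdd_aboveI2)
    fix v assume v: "v \<in> ?V"
    \<comment> \<open>\<open>C\<close> has no prescribed sign, while the quotient is
      \<open>0\<close> when the denominator vanishes; \<open>max 0 C\<close> covers both.\<close>
    have "l2norm X (B v) \<le> max 0 C * l2norm X v"
      using v C[of v] mult_right_mono[OF max.cobounded2[of C 0] l2norm_nonneg[of X v]] by simp
    then show "l2norm X (B v) / l2norm X v \<le> max 0 C"
      using l2norm_nonneg[of X v] by (cases "l2norm X v = 0") (simp_all add: divide_le_eq)
  qed
  then have upper: "l2norm X (B v) / l2norm X v \<le> op_norm X V B" if "v \<in> ?V" for v
    unfolding op_norm_def using that by (rule cSUP_upper2) auto
  show "0 \<le> op_norm X V B"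
    using upper[of 0] zero square_summable_zero by (auto simp: l2norm_zero)
  assume v: "v \<in> V" "square_summable X v"
  show "square_summable X (B v)" using C[OF v] by simp
  show "l2norm X (B v) \<le> op_norm X V B * l2norm X v"
  \<comment> \<open>For \<open>l2norm X v = 0\<close> the quotient carries no information, and the
    bound with \<open>C\<close> is used directly.\<close>
  proof (cases "l2norm X v = 0")
    case True
    then show ?thesis using C[OF v] by simp
  next
    case False
    then show ?thesis using upper[of v] v l2norm_nonneg[of X v] by (simp add: divide_le_eq)
  qed
qed

lemma norm_of_real_fun: "norm (of_real_fun v \<xi>) = norm (v \<xi>)"
  by (simp add: of_real_fun_def norm_vec_def L2_set_def)

lemma square_summable_of_real_fun: "square_summable X (of_real_fun v) \<longleftrightarrow> square_summable X v"
  by (simp add: square_summable_def norm_of_real_fun)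

lemma l2norm_of_real_fun: "l2norm X (of_real_fun v) = l2norm X v"
  by (simp add: l2norm_def norm_of_real_fun)

text \<open>\<open>1 / (1 - s) * Y\<close> is the fixed point of the map sending \<open>t\<close> to
  \<open>s * t + Y\<close>, and the deviation from it is multiplied by \<open>s\<close> in each
  step. Only \<open>0 \<le> s\<close> enters the monotonicity argument, so \<open>s > 1\<close> is
  included.\<close>

lemma affine_recursion_bound:
  fixes a :: "nat \<Rightarrow> real"
  assumes "a 0 \<le> A" "\<And>k. a (Suc k) \<le> s * a k + Y" "0 \<le> s" "s \<noteq> 1"
  shows "a k \<le> s ^ k * (A - 1 / (1 - s) * Y) + 1 / (1 - s) * Y"
proof (induction k)
  case 0
  then show ?case using assms(1) by simp
next
  case (Suc k)
  have "a (Suc k) \<le> s * (s ^ k * (A - 1 / (1 - s) * Y) + 1 / (1 - s) * Y) + Y"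
    using assms(2)[of k] mult_left_mono[OF Suc assms(3)] by linarith
  also have "\<dots> = s ^ Suc k * (A - 1 / (1 - s) * Y) + 1 / (1 - s) * Y"
  proof -
    have "s * (1 / (1 - s) * Y) + Y = 1 / (1 - s) * Y"
      using assms(4) by (simp add: field_simps)
    then show ?thesis by (simp add: distrib_left)
  qed
  finally show ?case .
qed

text \<open>The whole recursion runs in the coordinates \<open>x k\<close>, where one step costs
  just the factor \<open>s\<close>. The norms of \<open>Q\<close> and its inverse are therefore paid
  once each, on leaving and on entering these coordinates, and not in every step.\<close>

lemma diagonalized_iteration_bound:
  fixes e :: "nat \<Rightarrow> 'a \<Rightarrow> complex^'d"
  assumes W: "clinear_space W" and ed: "eigendecomposition W B Q mu"
    and s: "0 \<le> s" "s \<noteq> 1" and mu: "\<And>\<xi> i. \<xi> \<in> X \<Longrightarrow> cmod (mu \<xi> $ i) \<le> s"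
    and Qb: "l2_bounded X W Q" and Qb': "l2_bounded X W (inv_into W Q)"
    and e: "e 0 \<in> W" "\<And>k. e (Suc k) = B (e k) - t" and t: "t \<in> W"
    and summable: "square_summable X (e 0)" "square_summable X t"
  shows "square_summable X (e k)"
    and "l2norm X (e k) \<le> s ^ k * op_norm X W Q * op_norm X W (inv_into W Q)
        * (l2norm X (e 0) - 1 / (1 - s) * l2norm X t)
      + 1 / (1 - s) * op_norm X W Q * op_norm X W (inv_into W Q) * l2norm X t"
proof -
  let ?R = "inv_into W Q" and ?q = "op_norm X W Q" and ?r = "op_norm X W (inv_into W Q)"
  have Q: "clinear_on W Q" "inj_on Q W" "Q ` W = W" "\<And>w. w \<in> W \<Longrightarrow> diag_op mu w \<in> W"
    "\<And>w. w \<in> W \<Longrightarrow> B w = Q (diag_op mu (?R w))"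
    using ed by (auto simp: eigendecomposition_def bij_betw_def)
  have zero: "0 \<in> W" using W by (rule clinear_spaceD)
  have R: "?R w \<in> W" "Q (?R w) = w" if "w \<in> W" for w
    using inv_into_into[of w Q W] f_inv_into_f[of w Q W] that Q(3) by simp_all
  define x where "x k = ?R (e k)" for k
  define y where "y = ?R t"
  have eW: "e k \<in> W" for k
  proof (induction k)
    case (Suc k)
    have "Q (diag_op mu (?R (e k))) \<in> W" using Q(3,4) R(1)[OF Suc] by blast
    then show ?case
      unfolding e(2) Q(5)[OF Suc] using t by (rule clinear_space_diff[OF W])
  qed (rule e)
  have xW: "x k \<in> W" and yW: "y \<in> W" for k
    using R eW t by (auto simp: x_def y_def)
  have rec: "x (Suc k) = diag_op mu (x k) - y" for k
  proof -
    have "e (Suc k) = Q (diag_op mu (x k)) - Q y"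
      using Q(5) eW R(2)[OF t] by (simp add: e(2) x_def y_def)
    also have "\<dots> = Q (diag_op mu (x k) - y)"
      using clinear_on_diff[OF Q(1) W] Q(4) xW yW by simp
    finally show ?thesis
      unfolding x_def[of "Suc k"]
      using inv_into_f_f[OF Q(2)] clinear_space_diff[OF W Q(4)[OF xW] yW] by simp
  qed
  note Rb = op_norm_bound[OF Qb' zero]
  have ys: "square_summable X y" using Rb(2)[OF t summable(2)] by (simp add: y_def)
  have xs: "square_summable X (x k)" for k
  proof (induction k)
    case 0
    then show ?case using Rb(2)[OF e(1) summable(1)] by (simp add: x_def)
  next
    case (Suc k)
    then show ?case unfolding rec by (intro l2norm_diff(1) l2norm_diag_op(1)[OF s(1)] mu ys)
  qed
  have "l2norm X (x k) \<le> s ^ k * (?r * l2norm X (e 0) - 1 / (1 - s) * (?r * l2norm X t))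
      + 1 / (1 - s) * (?r * l2norm X t)"
  proof (rule affine_recursion_bound[OF _ _ s])
    show "l2norm X (x 0) \<le> ?r * l2norm X (e 0)"
      unfolding x_def by (rule Rb(3)[OF e(1) summable(1)])
    fix k
    have "l2norm X (x (Suc k)) \<le> l2norm X (diag_op mu (x k)) + l2norm X y"
      unfolding rec by (intro l2norm_diff(2) l2norm_diag_op(1)[OF s(1)] mu ys xs)
    also have "\<dots> \<le> s * l2norm X (x k) + ?r * l2norm X t"
      using l2norm_diag_op(2)[OF s(1) mu xs] Rb(3)[OF t summable(2)]
      unfolding y_def by (rule add_mono)
    finally show "l2norm X (x (Suc k)) \<le> s * l2norm X (x k) + ?r * l2norm X t" .
  qed
  note xbound = this
  have ex: "e k = Q (x k)" using R(2)[OF eW] by (simp add: x_def)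
  note Qb = op_norm_bound[OF Qb zero]
  show "square_summable X (e k)" unfolding ex by (rule Qb(2)[OF xW xs])
  have "l2norm X (e k) \<le> ?q * l2norm X (x k)" unfolding ex by (rule Qb(3)[OF xW xs])
  also have "\<dots> \<le> ?q * (s ^ k * (?r * l2norm X (e 0) - 1 / (1 - s) * (?r * l2norm X t))
      + 1 / (1 - s) * (?r * l2norm X t))"
    using xbound Qb(1) by (rule mult_left_mono)
  also have "\<dots> = s ^ k * ?q * ?r * (l2norm X (e 0) - 1 / (1 - s) * l2norm X t)
      + 1 / (1 - s) * ?q * ?r * l2norm X t"
    by (simp add: algebra_simps)
  finally show "l2norm X (e k) \<le> s ^ k * ?q * ?r
        * (l2norm X (e 0) - 1 / (1 - s) * l2norm X t)
      + 1 / (1 - s) * ?q * ?r * l2norm X t" .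
qed


subsection \<open>The Sinclair iteration\<close>

locale coupled_problem =
  fixes P :: "'d::finite problem"
  assumes well_posed: "well_posed P"
begin

abbreviation "a \<equiv> atoms P"
abbreviation "c \<equiv> cont P"

lemma disjoint: "a \<inter> c = {}"
  and finite_atoms: "finite a"
  and lattice_atoms: "a \<subseteq> bravais (cell P)"
  and lattice_cont: "c \<subseteq> bravais (cell P)"
  and rng_lattice: "\<And>\<xi>. \<xi> \<in> bravais (cell P) \<Longrightarrow> finite (rng P \<xi>) \<and> rng P \<xi> \<subseteq> bravais (cell P)"
  and rng_h_rng: "\<And>\<xi>. \<xi> \<in> bravais (cell P) \<Longrightarrow> rng_h P \<xi> \<subseteq> rng P \<xi>"
  and rng_atoms: "\<And>\<xi>. \<xi> \<in> a \<Longrightarrow> rng P \<xi> \<subseteq> a \<union> pad P"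
  and linear_disp: "linear_space (disp P)"
  and disp_domain: "disp P \<subseteq> funs_on (comp_domain P)"
  and finitely_supported_disp:
    "\<And>v. v \<in> funs_on (comp_domain P) \<Longrightarrow> finitely_supported v \<Longrightarrow> v \<in> disp P"
  and linear_force: "linear_space (force P)"
  and L_h_force: "\<And>v y. v \<in> disp P \<Longrightarrow> y \<in> {a, c} \<Longrightarrow> block c y (L_h P) v \<in> force P"
  and L_hnl_force: "\<And>v y. v \<in> disp P \<Longrightarrow> y \<in> {a, c} \<Longrightarrow> block c y (L_hnl P) v \<in> force P"
  and bij_hnl: "bij_betw (block a a (L_hnl P)) (funs_on a) (funs_on a)"
  and bij_h: "bij_betw (block a a (L_h P)) (funs_on a) (funs_on a)"
  and bij_Schur: "bij_betw (Schur P) (cont_disp P) (force P)"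
  using well_posed unfolding well_posed_def by (elim conjE; blast)+

lemma finite_pad: "finite (pad P)"
proof (rule finite_subset)
  show "pad P \<subseteq> (\<Union>\<xi>\<in>a. rng P \<xi>)" by (auto simp: pad_def)
  show "finite (\<Union>\<xi>\<in>a. rng P \<xi>)" using finite_atoms lattice_atoms rng_lattice by blast
qed

lemma pad_subset: "pad P \<subseteq> c"
  by (auto simp: pad_def)

lemma funs_on_disp:
  assumes "finite X" "X \<subseteq> comp_domain P"
  shows "funs_on X \<subseteq> disp P"
proof
  fix v :: "real^'d \<Rightarrow> real^'d" assume v: "v \<in> funs_on X"
  then have "v \<in> funs_on (comp_domain P)" using funs_on_mono[OF assms(2)] by blast
  moreover have "finitely_supported v"
    using restr_finite_support[OF assms(1), of v] by (simp only: restr_funs_on[OF v])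
  ultimately show "v \<in> disp P" by (rule finitely_supported_disp)
qed

lemma funs_on_atoms_disp: "funs_on a \<subseteq> disp P"
  by (rule funs_on_disp[OF finite_atoms]) (simp add: comp_domain_def)

lemma funs_on_pad_disp: "funs_on (pad P) \<subseteq> disp P"
  by (rule funs_on_disp[OF finite_pad]) (use pad_subset in \<open>auto simp: comp_domain_def\<close>)

lemma restr_disp:
  assumes "v \<in> disp P"
  shows "restr a v \<in> disp P" "restr c v \<in> disp P" "restr c v \<in> cont_disp P" "restr (pad P) v \<in> disp P"
    and "v = restr a v + restr c v"
proof -
  show ra: "restr a v \<in> disp P" using funs_on_atoms_disp by auto
  show eq: "v = restr a v + restr c v"
    using assms disp_domain disjoint by (auto simp: restr_def funs_on_def comp_domain_def fun_eq_iff)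
  \<comment> \<open>The continuum domain may be infinite, so finite support is no argument for this
    part; it is a difference of two members of \<open>disp P\<close>.\<close>
  have "v - restr a v = restr c v" using eq by (metis add_diff_cancel_left')
  then show rc: "restr c v \<in> disp P" using linear_space_diff[OF linear_disp assms ra] by (simp only:)
  then show "restr c v \<in> cont_disp P" by (simp add: cont_disp_def)
  show "restr (pad P) v \<in> disp P"
    using funs_on_pad_disp by auto
qed

lemma rlinear_L: "rlinear_on V (L_hnl P)" "rlinear_on V (L_h P)"
  unfolding rlinear_on_def L_hnl_def L_h_def
  by (auto simp: fun_eq_iff matrix_vector_right_distrib sum.distrib scaleR_sum_right
      matrix_vector_mult_scaleR)

lemmas rlinear_block = rlinear_on_block[OF rlinear_L(1)] rlinear_on_block[OF rlinear_L(2)]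

lemma rlinear_hnl_aa_inv: "rlinear_on (funs_on a) (hnl_aa_inv P)"
  unfolding hnl_aa_inv_def
  by (rule rlinear_on_inv_into[OF linear_space_funs_on rlinear_block(1) bij_hnl])

lemma hnl_aa_inv_in: "f \<in> funs_on a \<Longrightarrow> hnl_aa_inv P f \<in> funs_on a"
  unfolding hnl_aa_inv_def using bij_hnl by (metis bij_betw_imp_surj_on inv_into_into)

lemma hnl_aa_inv_block:
  assumes "v \<in> funs_on a" "block a a (L_hnl P) v = f"
  shows "hnl_aa_inv P f = v"
  unfolding hnl_aa_inv_def assms(2)[symmetric]
  using bij_hnl assms(1) by (auto simp: bij_betw_def inv_into_f_f)

section \<open>Response of the atoms to a frozen continuum, and the Schur complement\<close>

definition h_aa_inv :: "(real^'d \<Rightarrow> real^'d) \<Rightarrow> real^'d \<Rightarrow> real^'d" where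
  "h_aa_inv = inv_into (funs_on a) (block a a (L_h P))"

lemma rlinear_h_aa_inv: "rlinear_on (funs_on a) h_aa_inv"
  unfolding h_aa_inv_def
  by (rule rlinear_on_inv_into[OF linear_space_funs_on rlinear_block(2) bij_h])

lemma h_aa_inv_in: "f \<in> funs_on a \<Longrightarrow> h_aa_inv f \<in> funs_on a"
  unfolding h_aa_inv_def using bij_h by (metis bij_betw_imp_surj_on inv_into_into)

text \<open>Up to sign, the relaxed displacement of the atoms for a fixed continuum displacement
  without external force. Its harmonic counterpart \<open>h_response\<close> is the inner part of
  the Schur complement, so \<open>T_iter P\<close> can be written through the two responses.\<close>

definition hnl_response :: "(real^'d \<Rightarrow> real^'d) \<Rightarrow> real^'d \<Rightarrow> real^'d" where
  "hnl_response v = hnl_aa_inv P (block a c (L_hnl P) v)"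

definition h_response :: "(real^'d \<Rightarrow> real^'d) \<Rightarrow> real^'d \<Rightarrow> real^'d" where
  "h_response v = h_aa_inv (block a c (L_h P) v)"

lemma response_in: "hnl_response v \<in> funs_on a" "h_response v \<in> funs_on a"
  by (simp_all add: hnl_response_def h_response_def hnl_aa_inv_in h_aa_inv_in)

lemma response_disp: "hnl_response v \<in> disp P" "h_response v \<in> disp P"
  using response_in funs_on_atoms_disp by auto

lemma rlinear_response: "rlinear_on V hnl_response" "rlinear_on V h_response"
  unfolding hnl_response_def[abs_def] h_response_def[abs_def]
  by (rule rlinear_on_compose[OF rlinear_block(1) rlinear_hnl_aa_inv], simp)
    (rule rlinear_on_compose[OF rlinear_block(2) rlinear_h_aa_inv], simp)

lemma Schur_eq: "Schur P v = block c c (L_h P) v - block c a (L_h P) (h_response v)"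
  by (simp add: Schur_def h_response_def h_aa_inv_def)

lemma rlinear_Schur: "rlinear_on V (Schur P)"
  unfolding Schur_eq[abs_def]
  by (intro rlinear_on_minus_fun rlinear_block
      rlinear_on_compose[OF rlinear_response(2) rlinear_block(2)[of UNIV]]) simp

lemma linear_cont_disp: "linear_space (cont_disp P)"
  unfolding cont_disp_def by (intro linear_space_Int linear_disp linear_space_funs_on)

lemma rlinear_Schur_inv: "rlinear_on (force P) (Schur_inv P)"
  unfolding Schur_inv_def
  by (rule rlinear_on_inv_into[OF linear_cont_disp rlinear_Schur bij_Schur])

lemma Schur_inv_in: "f \<in> force P \<Longrightarrow> Schur_inv P f \<in> cont_disp P"
  unfolding Schur_inv_def using bij_Schur by (metis bij_betw_imp_surj_on inv_into_into)

lemma Schur_inv_Schur: "v \<in> cont_disp P \<Longrightarrow> Schur_inv P (Schur P v) = v"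
  unfolding Schur_inv_def using bij_Schur by (auto simp: bij_betw_def inv_into_f_f)

lemma Schur_inv_disp: "f \<in> force P \<Longrightarrow> Schur_inv P f \<in> disp P"
  using Schur_inv_in by (simp add: cont_disp_def)

lemma T_iter_unfold:
  "T_iter P v = - hnl_response v +
     (restr c v - Schur_inv P (block c c (L_h P) v - block c a (L_h P) (hnl_response v)))"
  by (simp add: T_iter_def hnl_response_def)

lemma T_iter_force: "v \<in> disp P \<Longrightarrow>
    block c c (L_h P) v - block c a (L_h P) (hnl_response v) \<in> force P"
  using L_h_force response_disp by (intro linear_space_diff[OF linear_force]) auto

lemma T_iter_disp: "v \<in> disp P \<Longrightarrow> T_iter P v \<in> disp P"
  unfolding T_iter_unfold
  by (intro linear_spaceD(2) linear_space_diff linear_space_uminus linear_disp response_disp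
      restr_disp Schur_inv_disp T_iter_force)

lemma rlinear_T_iter: "rlinear_on (disp P) (T_iter P)"
  unfolding T_iter_unfold[abs_def]
  by (intro rlinear_on_add_fun rlinear_on_uminus_fun rlinear_on_minus_fun rlinear_response
      rlinear_on_restr rlinear_block rlinear_on_compose[OF _ rlinear_Schur_inv]
      rlinear_on_compose[OF rlinear_response(1) rlinear_block(2)[of UNIV]] T_iter_force) auto

text \<open>
  The identity in the continuum block cancels against \<open>S\<^sup>-\<^sup>1 S\<close>; what remains only sees the
  continuum displacement through the forces on the atoms, hence through the pad.
\<close>

lemma T_iter_response:
  assumes v: "v \<in> disp P"
  shows "T_iter P v =
    - hnl_response v - Schur_inv P (block c a (L_h P) (h_response v - hnl_response v))"
proof -
  let ?d = "h_response v - hnl_response v"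
  have d: "?d \<in> disp P" using response_disp by (intro linear_space_diff[OF linear_disp])
  have "h_response (restr c v) = h_response v"
    by (simp add: h_response_def block_restr)
  then have S: "Schur P (restr c v) = block c c (L_h P) v - block c a (L_h P) (h_response v)"
    by (simp add: Schur_eq block_restr)
  have "block c a (L_h P) ?d = block c a (L_h P) (h_response v) - block c a (L_h P) (hnl_response v)"
    by (rule rlinear_on_diff[OF rlinear_block(2) linear_disp response_disp(2,1)])
  \<comment> \<open>Adding and subtracting the harmonic response exhibits
    \<open>Schur P (restr c v)\<close>. Both summands lie in \<open>force P\<close>, where
    \<open>Schur_inv P\<close> is additive.\<close>
  then have "block c c (L_h P) v - block c a (L_h P) (hnl_response v)
      = Schur P (restr c v) + block c a (L_h P) ?d"
    unfolding S by (simp add: algebra_simps)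
  moreover have "Schur P (restr c v) \<in> force P"
    using bij_betwE[OF bij_Schur] restr_disp(3)[OF v] by blast
  ultimately have "Schur_inv P (block c c (L_h P) v - block c a (L_h P) (hnl_response v))
      = restr c v + Schur_inv P (block c a (L_h P) ?d)"
    using rlinear_onD(1)[OF rlinear_Schur_inv] L_h_force[OF d]
      Schur_inv_Schur[OF restr_disp(3)[OF v]] by simp
  then show ?thesis unfolding T_iter_unfold by (simp add: algebra_simps)
qed

text \<open>The range of an atom stays within atoms and pad, and the harmonic range is contained in
  it. The restriction to the continuum removes the atoms, so the pad values alone enter both
  forces.\<close>

lemma response_restr_pad:
  "hnl_response (restr (pad P) v) = hnl_response v" "h_response (restr (pad P) v) = h_response v"
proof -
  have "restr c (restr (pad P) v) \<eta> = restr c v \<eta>" if "\<xi> \<in> a" "\<eta> \<in> rng P \<xi>" for \<xi> \<eta>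
    using rng_atoms[OF that(1)] that(2) disjoint pad_subset by (auto simp: restr_def)
  moreover have "rng_h P \<xi> \<subseteq> rng P \<xi>" if "\<xi> \<in> a" for \<xi>
    using rng_h_rng that lattice_atoms by blast
  ultimately have "block a c (L_hnl P) (restr (pad P) v) = block a c (L_hnl P) v"
    "block a c (L_h P) (restr (pad P) v) = block a c (L_h P) v"
    unfolding block_def restr_def[of a] L_hnl_def L_h_def
    by (intro ext if_cong refl sum.cong arg_cong2[where f = "(*v)"]; blast)+
  then show "hnl_response (restr (pad P) v) = hnl_response v"
    "h_response (restr (pad P) v) = h_response v"
    by (simp_all add: hnl_response_def h_response_def)
qed

lemma T_iter_restr_pad: "v \<in> disp P \<Longrightarrow> T_iter P (restr (pad P) v) = T_iter P v"
  by (simp add: T_iter_response restr_disp(4) response_restr_pad)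

text \<open>Both columns are forces in \<open>force P\<close>, so additivity of
  \<open>Schur_inv P\<close> merges them into one mismatch force, the form in which the modeling
  error appears in the recursion.\<close>

lemma T_err_eq:
  assumes "v \<in> disp P"
  shows "T_err P v = Schur_inv P
    ((block c a (L_hnl P) v - block c a (L_h P) v) + (block c c (L_hnl P) v - block c c (L_h P) v))"
    and "(block c a (L_hnl P) v - block c a (L_h P) v) + (block c c (L_hnl P) v - block c c (L_h P) v)
      \<in> force P"
proof -
  have f: "block c a (L_hnl P) v - block c a (L_h P) v \<in> force P"
    "block c c (L_hnl P) v - block c c (L_h P) v \<in> force P"
    using L_hnl_force[OF assms] L_h_force[OF assms] by (auto intro: linear_space_diff[OF linear_force])
  then show "(block c a (L_hnl P) v - block c a (L_h P) v) + (block c c (L_hnl P) v - block c c (L_h P) v)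
      \<in> force P"
    by (rule linear_spaceD(2)[OF linear_force])
  show "T_err P v = Schur_inv P
    ((block c a (L_hnl P) v - block c a (L_h P) v) + (block c c (L_hnl P) v - block c c (L_h P) v))"
    unfolding T_err_def using rlinear_onD(1)[OF rlinear_Schur_inv f] by simp
qed

section \<open>Error of one Sinclair step\<close>

lemma block_a_a: "block a a L (restr a u) = block a a L u"
  by (simp add: block_def)

text \<open>The reference solution carries boundary values and need not be in \<open>disp P\<close>;
  this lets the facts about \<open>T_err\<close> be applied to its restriction.\<close>

lemma T_err_domain: "T_err P (restr (comp_domain P) u) = T_err P u"
  unfolding T_err_def by (simp add: block_restr comp_domain_def)

lemma T_err_disp: "restr (comp_domain P) u \<in> disp P \<Longrightarrow> T_err P u \<in> disp P"
  using T_err_eq[of "restr (comp_domain P) u"] Schur_inv_disp by (simp add: T_err_domain)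

lemma L_hnl_split:
  assumes "\<xi> \<in> bravais (cell P)"
  shows "L_hnl P u \<xi> = L_hnl P (restr a u) \<xi> + L_hnl P (restr c u) \<xi> + L_hnl P (restr (exterior P) u) \<xi>"
  unfolding L_hnl_def sum.distrib[symmetric] matrix_vector_right_distrib[symmetric]
proof (rule sum.cong)
  fix \<eta> assume "\<eta> \<in> rng P \<xi>"
  then have "\<eta> \<in> bravais (cell P)" using rng_lattice[OF assms] by blast
  then have "u \<eta> = restr a u \<eta> + restr c u \<eta> + restr (exterior P) u \<eta>"
    using disjoint by (auto simp: restr_def exterior_def comp_domain_def)
  then show "K_hnl P \<xi> \<eta> *v u \<eta> = K_hnl P \<xi> \<eta> *v (restr a u \<eta> + restr c u \<eta> + restr (exterior P) u \<eta>)"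
    by simp
qed simp

text \<open>Atoms do not reach the exterior, so their row has no boundary term. In the continuum row
  that term remains, with the solution replaced by its prescribed values.\<close>

lemma atomistic_solution_blocks:
  assumes "atomistic_solution P u"
  shows "block a a (L_hnl P) u + block a c (L_hnl P) u = restr a (f_ext P)"
    and "block c a (L_hnl P) u + block c c (L_hnl P) u + block c (exterior P) (L_hnl P) (ubar P)
      = restr c (f_ext P)"
proof -
  have sol: "L_hnl P u \<xi> = f_ext P \<xi>" if "\<xi> \<in> a \<union> c" for \<xi>
    using assms that by (simp add: atomistic_solution_def comp_domain_def)
  have ext: "restr (exterior P) u = restr (exterior P) (ubar P)"
    using assms by (auto simp: atomistic_solution_def admissible_def restr_def exterior_def fun_eq_iff)
  have "L_hnl P (restr (exterior P) u) \<xi> = 0" if "\<xi> \<in> a" for \<xi>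
    unfolding L_hnl_def
  proof (rule sum.neutral, rule ballI)
    fix \<eta> assume "\<eta> \<in> rng P \<xi>"
    then have "\<eta> \<notin> exterior P" using rng_atoms[OF that] pad_subset by (auto simp: exterior_def comp_domain_def)
    then show "K_hnl P \<xi> \<eta> *v restr (exterior P) u \<eta> = 0" by (simp add: restr_def)
  qed
  then have "L_hnl P (restr a u) \<xi> + L_hnl P (restr c u) \<xi> = f_ext P \<xi>" if "\<xi> \<in> a" for \<xi>
    using L_hnl_split[of \<xi> u] sol[of \<xi>] that lattice_atoms by auto
  then show "block a a (L_hnl P) u + block a c (L_hnl P) u = restr a (f_ext P)"
    unfolding block_def restr_add[symmetric] by (auto simp: restr_def[of a] fun_eq_iff)
  have "L_hnl P (restr a u) \<xi> + L_hnl P (restr c u) \<xi> + L_hnl P (restr (exterior P) (ubar P)) \<xi>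
      = f_ext P \<xi>" if "\<xi> \<in> c" for \<xi>
    using L_hnl_split[of \<xi> u] sol[of \<xi>] that lattice_cont ext by auto
  then show "block c a (L_hnl P) u + block c c (L_hnl P) u + block c (exterior P) (L_hnl P) (ubar P)
      = restr c (f_ext P)"
    unfolding block_def restr_add[symmetric] by (auto simp: restr_def[of c] fun_eq_iff)
qed

text \<open>Each row of the step is subtracted from the reference equation, so the external force
  cancels. Consistency of the boundary forces removes the boundary terms of the two models, and what
  is left of the mismatch is the force inside \<open>T_err\<close>.\<close>

lemma error_recursion:
  assumes ref: "atomistic_solution P v" and step: "sinclair_step P u u'"
    and adm: "admissible P u" and cons: "consistent_boundary_force P"
  shows "v - u' = T_iter P (v - u) - T_err P v" "admissible P u'"
proof -
  let ?D = "comp_domain P" and ?e = "v - u" and ?e' = "v - u'"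
  have "admissible P v" using ref by (simp add: atomistic_solution_def)
  then have v: "restr ?D v \<in> disp P" "\<And>\<xi>. \<xi> \<notin> ?D \<Longrightarrow> v \<xi> = ubar P \<xi>"
    by (auto simp: admissible_def)
  have u: "restr ?D u \<in> disp P" "\<And>\<xi>. \<xi> \<notin> ?D \<Longrightarrow> u \<xi> = ubar P \<xi>"
    using adm by (auto simp: admissible_def)
  have aa: "block a a (L_hnl P) u' + block a c (L_hnl P) u = restr a (f_ext P)"
    and cc: "restr c u' = restr c u - Schur_inv P (inhomogeneous_force P u' u)"
    and u': "\<And>\<xi>. \<xi> \<notin> ?D \<Longrightarrow> u' \<xi> = ubar P \<xi>"
    using step by (auto simp: sinclair_step_def)
  \<comment> \<open>The blocks are linear on all functions; this matters for \<open>u'\<close>,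
    whose membership in the displacement space is only established at the end.\<close>
  note diffs = rlinear_on_diff[OF rlinear_block(1) linear_space_funs_on[of UNIV]]
    rlinear_on_diff[OF rlinear_block(2) linear_space_funs_on[of UNIV]]
  have UN: "w \<in> funs_on UNIV" for w :: "real^'d \<Rightarrow> real^'d" by (simp add: funs_on_def)
  note diffs = diffs[OF UN UN]
  have e: "?e \<in> disp P"
  proof -
    have "?e = restr ?D v - restr ?D u" using v(2) u(2) by (auto simp: restr_def fun_eq_iff)
    then show ?thesis using linear_space_diff[OF linear_disp v(1) u(1)] by metis
  qed
  have "block a a (L_hnl P) (restr a ?e') = block a c (L_hnl P) (- ?e)"
    using aa atomistic_solution_blocks(1)[OF ref]
    unfolding block_a_a diffs minus_diff_eq by (simp add: algebra_simps fun_eq_iff)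
  then have "hnl_aa_inv P (block a c (L_hnl P) (- ?e)) = restr a ?e'"
    by (intro hnl_aa_inv_block) auto
  moreover have "hnl_response (- ?e) = - hnl_response ?e"
    by (rule rlinear_on_uminus[OF rlinear_response(1)[of UNIV]]) simp
  ultimately have ea: "restr a ?e' = - hnl_response ?e"
    by (simp add: hnl_response_def)
  let ?m = "(block c a (L_hnl P) v - block c a (L_h P) v) + (block c c (L_hnl P) v - block c c (L_h P) v)"
  let ?t = "block c c (L_h P) ?e - block c a (L_h P) (hnl_response ?e)"
  have m: "?m \<in> force P" "T_err P v = Schur_inv P ?m"
    using T_err_eq[OF v(1)] T_err_domain[of v] by (simp_all add: block_restr comp_domain_def)
  have t: "?t \<in> force P" by (rule T_iter_force[OF e])
  have "block c a (L_h P) ?e' = block c a (L_h P) (restr a ?e')" by (simp add: block_restr)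
  also have "\<dots> = - block c a (L_h P) (hnl_response ?e)"
    unfolding ea by (rule rlinear_on_uminus[OF rlinear_block(2)[of UNIV]]) simp
  finally have ca: "block c a (L_h P) v - block c a (L_h P) u' = - block c a (L_h P) (hnl_response ?e)"
    unfolding diffs .
  \<comment> \<open>The reference equation is inserted for the external force; \<open>?t\<close>
    collects the harmonic force of the error, with its atomistic part expressed by
    \<open>ca\<close>, and \<open>?m\<close> the difference of the two operators on
    \<open>v\<close>.\<close>
  have inh: "inhomogeneous_force P u' u = - (?t + ?m)"
  proof
    fix \<xi>
    show "inhomogeneous_force P u' u \<xi> = (- (?t + ?m)) \<xi>"
      using fun_cong[OF ca, of \<xi>] fun_cong[OF atomistic_solution_blocks(2)[OF ref], of \<xi>]
        fun_cong[OF cons[unfolded consistent_boundary_force_def], of \<xi>]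
      unfolding inhomogeneous_force_def diffs by (simp add: algebra_simps)
  qed
  have tm: "?t + ?m \<in> force P" using linear_spaceD(2)[OF linear_force t m(1)] .
  have "Schur_inv P (inhomogeneous_force P u' u) = - Schur_inv P (?t + ?m)"
    unfolding inh by (rule rlinear_on_uminus[OF rlinear_Schur_inv tm])
  also have "\<dots> = - (Schur_inv P ?t + T_err P v)"
    unfolding m(2) rlinear_onD(1)[OF rlinear_Schur_inv t m(1)] ..
  finally have "restr c u' = restr c u + (Schur_inv P ?t + T_err P v)"
    unfolding cc by simp
  then have ec: "restr c ?e' = restr c ?e - Schur_inv P ?t - T_err P v"
    unfolding restr_diff by (simp add: algebra_simps)
  have "?e' = restr a ?e' + restr c ?e'"
    using v(2) u' disjoint by (auto simp: restr_def fun_eq_iff comp_domain_def)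
  also have "\<dots> = T_iter P ?e - T_err P v"
    unfolding ea ec T_iter_unfold by (simp add: algebra_simps)
  finally show rec: "?e' = T_iter P ?e - T_err P v" .
  \<comment> \<open>A Sinclair step itself does not assert finite energy of \<open>u'\<close>; it
    follows from the recursion just proved.\<close>
  have "restr ?D u' = restr ?D v - ?e'"
    using v(2) u' by (auto simp: restr_def fun_eq_iff)
  moreover have "?e' \<in> disp P"
    unfolding rec by (intro linear_space_diff[OF linear_disp] T_iter_disp e T_err_disp v(1))
  ultimately show "admissible P u'"
    using linear_space_diff[OF linear_disp v(1)] u' by (simp add: admissible_def)
qed

end

text \<open>The summability and boundedness conditions ensure that the norms in the estimate are
  genuine: otherwise \<open>infsum\<close> returns \<open>0\<close> and \<open>SUP\<close> may be
  unspecified. The equality of the spectral radii stands outside the implication.\<close>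

theorem theorem1:
  fixes P :: "'d::finite problem"
    and u :: "nat \<Rightarrow> real^'d \<Rightarrow> real^'d"
    and u_ref :: "real^'d \<Rightarrow> real^'d"
    and Q :: "(real^'d \<Rightarrow> complex^'d) \<Rightarrow> real^'d \<Rightarrow> complex^'d"
    and mu :: "real^'d \<Rightarrow> complex^'d"
    and \<sigma> :: real
  assumes "well_posed P"
    and "reference_solution P u_ref"
    and "sinclair_iteration P u"
    and "eigendecomposition (cspace (disp P)) (cop (T_iter P)) Q mu"
    and "\<sigma> = op_spectral_radius (cspace (disp P)) (cop (T_iter P))"
  shows "(\<sigma> \<noteq> 1 \<and> consistent_boundary_force P \<and>
          l2_bounded (comp_domain P) (cspace (disp P)) Q \<and>
          l2_bounded (comp_domain P) (cspace (disp P)) (inv_into (cspace (disp P)) Q) \<and>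
          square_summable (comp_domain P) (u_ref - u 0) \<and>
          square_summable (comp_domain P) (T_err P u_ref)
          \<longrightarrow>
          (\<forall>k. square_summable (comp_domain P) (u_ref - u (k + 1)) \<and>
             l2norm (comp_domain P) (u_ref - u (k + 1)) \<le>
               \<sigma> ^ (k + 1) * op_norm (comp_domain P) (cspace (disp P)) Q
                 * op_norm (comp_domain P) (cspace (disp P)) (inv_into (cspace (disp P)) Q)
                 * (l2norm (comp_domain P) (u_ref - u 0)
                    - 1 / (1 - \<sigma>) * l2norm (comp_domain P) (T_err P u_ref))
               + 1 / (1 - \<sigma>) * op_norm (comp_domain P) (cspace (disp P)) Q
                 * op_norm (comp_domain P) (cspace (disp P)) (inv_into (cspace (disp P)) Q)
                 * l2norm (comp_domain P) (T_err P u_ref)))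
         \<and> \<sigma> = op_spectral_radius (cspace (funs_on (pad P))) (cop (block (pad P) (pad P) (T_iter P)))"
proof -
  interpret coupled_problem P using assms(1) by unfold_locales
  let ?W = "cspace (disp P)" and ?D = "comp_domain P" and ?T = "cop (T_iter P)"
  have W: "clinear_space ?W" by (rule clinear_space_cspace[OF linear_disp])
  have T: "?T w \<in> ?W" "?T (restr (pad P) w) = ?T w" if "w \<in> ?W" for w
    using that by (auto simp: cspace_def T_iter_disp T_iter_restr_pad intro!: complex_fun_eqI)
  have pad: "funs_on (pad P) \<subseteq> ?W"
    using cspace_mono[OF funs_on_pad_disp] by (simp only: cspace_funs_on)
  note radius = op_spectral_radius_block[of ?W ?T "pad P", OF W T(1) pad T(2)]
  have "\<sigma> = op_spectral_radius (cspace (funs_on (pad P))) (cop (block (pad P) (pad P) (T_iter P)))"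
    using radius(1) assms(5) by (simp add: cop_block cspace_funs_on)
  moreover
  have "rlinear_on (funs_on (pad P)) (block (pad P) (pad P) (T_iter P))"
    unfolding block_def[abs_def] using funs_on_pad_disp
    by (intro rlinear_on_compose[OF _ rlinear_on_restr[of UNIV]]
        rlinear_on_compose[OF rlinear_on_restr rlinear_T_iter]) auto
  then have "clinear_on (funs_on (pad P)) (block (pad P) (pad P) ?T)"
    using clinear_on_cop[OF linear_space_funs_on] by (metis cop_block cspace_funs_on)
  then have bdd: "bdd_above (cmod ` op_spectrum ?W ?T)"
    by (intro iffD2[OF radius(2)] bdd_above_op_spectrum[OF finite_pad]) auto
  \<comment> \<open>A unit function at a site of the domain is finitely supported and so lies in
    \<open>?W\<close>. Bounds at these sites suffice, since the norms see no others.\<close>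
  have mu: "cmod (mu \<xi> $ i) \<le> \<sigma>" if "\<xi> \<in> ?D" for \<xi> i
  proof -
    have "unit_fun \<xi> i \<in> funs_on {\<xi>}" by (simp add: unit_fun_in_funs_on)
    moreover have "funs_on {\<xi>} \<subseteq> ?W"
      using funs_on_disp[of "{\<xi>}"] that cspace_mono cspace_funs_on
      by (metis empty_subsetI finite.emptyI finite_insert insert_subset)
    ultimately show ?thesis
      unfolding assms(5) using eigendecomposition_eigenvalue_le[OF W assms(4) bdd] by blast
  qed
  \<comment> \<open>The inserted \<open>0\<close> is a member of the set whose supremum is
    taken.\<close>
  have \<sigma>: "0 \<le> \<sigma>"
    unfolding assms(5) op_spectral_radius_def using bdd by (intro cSup_upper) auto
  have ref: "atomistic_solution P u_ref" and adm0: "admissible P (u 0)"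
    and step: "\<And>k. sinclair_step P (u k) (u (Suc k))"
    using assms(2,3) by (auto simp: reference_solution_def sinclair_iteration_def)
  have ref_disp: "restr ?D u_ref \<in> disp P"
    using ref by (simp add: atomistic_solution_def admissible_def)
  have "square_summable ?D (u_ref - u k) \<and> l2norm ?D (u_ref - u k) \<le>
      \<sigma> ^ k * op_norm ?D ?W Q * op_norm ?D ?W (inv_into ?W Q)
        * (l2norm ?D (u_ref - u 0) - 1 / (1 - \<sigma>) * l2norm ?D (T_err P u_ref))
      + 1 / (1 - \<sigma>) * op_norm ?D ?W Q * op_norm ?D ?W (inv_into ?W Q) * l2norm ?D (T_err P u_ref)"
    if hyp: "\<sigma> \<noteq> 1" "consistent_boundary_force P" "l2_bounded ?D ?W Q"
      "l2_bounded ?D ?W (inv_into ?W Q)" "square_summable ?D (u_ref - u 0)"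
      "square_summable ?D (T_err P u_ref)" for k
  proof -
    define e where "e k = of_real_fun (u_ref - u k)" for k
    have adm: "admissible P (u k)" for k
      by (induction k) (use adm0 error_recursion(2)[OF ref step _ hyp(2)] in auto)
    have T0: "T_iter P 0 = 0" by (rule rlinear_on_zero[OF rlinear_T_iter linear_disp])
    have rec: "e (Suc k) = ?T (e k) - of_real_fun (T_err P u_ref)" for k
      unfolding e_def cop_of_real_fun[of "T_iter P", OF T0] of_real_fun_diff[symmetric]
        error_recursion(1)[OF ref step adm hyp(2)] ..
    have "u_ref - u 0 = restr ?D u_ref - restr ?D (u 0)"
      using ref adm0 by (auto simp: atomistic_solution_def admissible_def restr_def fun_eq_iff)
    then have "u_ref - u 0 \<in> disp P"
      using linear_space_diff[OF linear_disp ref_disp, of "restr ?D (u 0)"] adm0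
      by (simp only: admissible_def)
    then have e0: "e 0 \<in> ?W"
      using linear_spaceD(1)[OF linear_disp] by (simp add: e_def cspace_def)
    have t: "of_real_fun (T_err P u_ref) \<in> ?W"
      using T_err_disp[OF ref_disp] linear_spaceD(1)[OF linear_disp] by (simp add: cspace_def)
    have ss: "square_summable ?D (e 0)" "square_summable ?D (of_real_fun (T_err P u_ref))"
      using hyp(5,6) by (simp_all only: e_def square_summable_of_real_fun)
    show ?thesis
      using diagonalized_iteration_bound[where e = e and k = k, OF W assms(4) \<sigma> hyp(1) mu hyp(3,4) e0 rec t ss]
      by (simp only: e_def square_summable_of_real_fun l2norm_of_real_fun)
  qed
  \<comment> \<open>The estimate holds at every index from \<open>0\<close> on; the claim is its
    instance at \<open>k + 1\<close>.\<close>
  then have "\<sigma> \<noteq> 1 \<and> consistent_boundary_force P \<and> l2_bounded ?D ?W Q \<and>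
      l2_bounded ?D ?W (inv_into ?W Q) \<and> square_summable ?D (u_ref - u 0) \<and>
      square_summable ?D (T_err P u_ref) \<longrightarrow>
      (\<forall>k. square_summable ?D (u_ref - u (k + 1)) \<and> l2norm ?D (u_ref - u (k + 1)) \<le>
        \<sigma> ^ (k + 1) * op_norm ?D ?W Q * op_norm ?D ?W (inv_into ?W Q)
          * (l2norm ?D (u_ref - u 0) - 1 / (1 - \<sigma>) * l2norm ?D (T_err P u_ref))
        + 1 / (1 - \<sigma>) * op_norm ?D ?W Q * op_norm ?D ?W (inv_into ?W Q) * l2norm ?D (T_err P u_ref))"
    by blast
  ultimately show ?thesis by blast
qed

end
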